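(* Let $n\ge 5$ and consider an $n$-dimensional asymptotically flat spacetime whose metric near future null infinity is given in Bondi coordinates $(u,r,x^I)$ by $C^{2-}$ (i.e. $C^{1,1}$) functions, with the asymptotic form described in the context. Put $$\dot r_{\rm crit}:=-\left(1-\frac{1}{\sqrt3}\right)\approx-0.423.$$ Then any photon emitted from a point $p$ with sufficiently large radial coordinate value $r=r_0$ reaches future null infinity if $$0<\frac{1}{\dot r|_p-\dot r_{\rm crit}}=o(r_0),$$ where $\dot r|_p$ is the value of $dr/du$ along the photon's worldline at $p$. Explicitly: for every function $\varepsilon:(0,\infty)\to(0,\infty)$ with $1/\varepsilon(r_0)=o(r_0)$ as $r_0\to\infty$, there is $R>0$ such that for every $r_0\ge R$, every point $p$ with $r(p)=r_0$, and every future-directed null geodesic starting at $p$ with $u'|_p\neq0$ and $\dot r|_p-\dot r_{\rm crit}\ge\varepsilon(r_0)$, the geodesic reaches future null infinity.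
   Context: Bondi coordinates: $u$ is the retarded time, $r$ the areal radius, $x^I$ ($I=1,\dots,n-2$) coordinates on the unit sphere $S^{n-2}$ with round metric $\omega_{IJ}$. The region near future null infinity is $\{r>R_0\}$, with $u$ ranging over an interval unbounded above and $x^I$ over $S^{n-2}$. There the metric is $$ds^2=-Ae^B\,du^2-2e^B\,du\,dr+h_{IJ}r^2(dx^I+C^I du)(dx^J+C^J du),$$ where $A,B,C^I,h_{IJ}$ are functions of $(u,r,x^I)$, subject to the gauge condition $\sqrt{\det h_{IJ}}=\sqrt{\det\omega_{IJ}}$. As $r\to\infty$, $$g_{uu}=-1-A^{(1)}r^{-(n/2-1)}+m\,r^{-(n-3)}+O(r^{-(n-1)/2}),\quad g_{ur}=-1-B^{(1)}r^{-(n-2)}+O(r^{-(n-3/2)}),$$ $$g_{IJ}=h_{IJ}r^2=\omega_{IJ}r^2+h^{(1)}_{IJ}r^{-(n/2-3)}+O(r^{-(n-5)/2}),\quad g_{uI}=h_{IJ}C^Jr^2=C^{(1)}_{\ \ I}r^{-(n/2-2)}+O(r^{-(n-3)/2}),$$ where $g_{rr}=g_{rI}=0$ and $A^{(1)},m,B^{(1)},C^{(1)}_{\ \ I},h^{(1)}_{IJ}$ are functions of $(u,x^I)$ only (in even dimensions each error term is in fact smaller by a further factor $r^{-1/2}$). These expansions may be differentiated term by term in $u,r,x^I$ to obtain the expansions of the Christoffel symbols ($\partial_r$ lowering the order by one), and all Landau symbols, including those absorbing the coefficient functions and their derivatives, are uniform in $(u,x^I)$. A photon is a future-directed affinely parametrized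 null geodesic; a prime denotes the derivative with respect to the affine parameter, and where $u'\ne0$ one sets $\dot r=dr/du=r'/u'$ along the geodesic. Future null infinity is the limit $r\to\infty$ with $u$ finite; a photon reaches future null infinity if, along its worldline to the future, $r\to\infty$ while $u$ stays bounded. *)

theory Defs
  imports "HOL-Analysis.Analysis" "HOL-Library.Landau_Symbols"
begin

section \<open>Coordinates\<close>

text \<open>With \<open>CARD('n) = n - 2\<close>, the unit sphere \<open>S\<^sup>n\<^sup>-\<^sup>2\<close> is \<open>sphere 0 1\<close> in the Euclidean space
  \<open>\<real> \<times> \<real>\<^sup>n\<^sup>-\<^sup>2\<close>, and a point of the spacetime is a triple \<open>(u, r, x)\<close>. Tangent vectors are represented
  in the surrounding vector space: those at \<open>(u, r, x)\<close> are the triples \<open>(a, b, v)\<close> with \<open>v\<close>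
  orthogonal to \<open>x\<close>.\<close>

type_synonym 'n ambient = "real \<times> (real^'n)"
type_synonym 'n event = "real \<times> real \<times> 'n ambient"

datatype 'n coord = Ucoord | Rcoord | Angle 'n

instance coord :: (finite) finite
proof
  have "(UNIV :: 'a coord set) = insert Ucoord (insert Rcoord (range Angle))"
    by (auto intro: coord.exhaust)
  then show "finite (UNIV :: 'a coord set)"
    by (metis finite.insertI finite_code finite_imageI)
qed

definition partial :: "'i::finite \<Rightarrow> (real^'i \<Rightarrow> 'b::real_normed_vector) \<Rightarrow> real^'i \<Rightarrow> 'b" where
  "partial i f z = frechet_derivative f (at z) (axis i 1)"

text \<open>The sphere is covered by the two stereographic charts, which project from the points
  \<open>(1, 0)\<close> and \<open>(-1, 0)\<close>. At its own pole the chart function takes the junk value \<open>0\<close>.\<close>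

definition pole :: "bool \<Rightarrow> real" where
  "pole c = (if c then 1 else -1)"

definition stereo :: "bool \<Rightarrow> 'n::finite ambient \<Rightarrow> real^'n" where
  "stereo c x = (1 / (1 - pole c * fst x)) *\<^sub>R snd x"

definition stereo_inv :: "bool \<Rightarrow> real^'n \<Rightarrow> 'n::finite ambient" where
  "stereo_inv c y =
    (pole c * ((norm y)\<^sup>2 - 1) / ((norm y)\<^sup>2 + 1), (2 / ((norm y)\<^sup>2 + 1)) *\<^sub>R y)"

definition angles :: "real^('n coord) \<Rightarrow> real^'n::finite" where
  "angles z = (\<chi> I. z $ Angle I)"

definition event_of :: "bool \<Rightarrow> real^('n coord) \<Rightarrow> 'n::finite event" where
  "event_of c z = (z $ Ucoord, z $ Rcoord, stereo_inv c (angles z))"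

definition coords_of :: "bool \<Rightarrow> 'n event \<Rightarrow> real^('n::finite coord)" where
  "coords_of c = (\<lambda>(u, r, x). \<chi> i. case i of Ucoord \<Rightarrow> u | Rcoord \<Rightarrow> r | Angle I \<Rightarrow> stereo c x $ I)"

definition chart_domain :: "bool \<Rightarrow> 'n::finite event set" where
  "chart_domain c = {(u, r, x). x \<noteq> (pole c, 0)}"

definition region :: "real set \<Rightarrow> real \<Rightarrow> 'n::finite event set" where
  "region T R0 = {(u, r, x). u \<in> T \<and> r > R0 \<and> x \<in> sphere 0 1}"

definition coord_region :: "real set \<Rightarrow> real \<Rightarrow> (real^('n::finite coord)) set" where
  "coord_region T R0 = {z. z $ Ucoord \<in> T \<and> z $ Rcoord > R0}"


section \<open>Metric, regularity and Landau symbols\<close>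

definition bondi_metric ::
  "(real \<Rightarrow> real \<Rightarrow> 'n ambient \<Rightarrow> real) \<Rightarrow> (real \<Rightarrow> real \<Rightarrow> 'n ambient \<Rightarrow> real) \<Rightarrow>
   (real \<Rightarrow> real \<Rightarrow> 'n ambient \<Rightarrow> 'n ambient) \<Rightarrow>
   (real \<Rightarrow> real \<Rightarrow> 'n ambient \<Rightarrow> 'n ambient \<Rightarrow> 'n ambient \<Rightarrow> real) \<Rightarrow>
   'n::finite event \<Rightarrow> 'n event \<Rightarrow> 'n event \<Rightarrow> real" where
  "bondi_metric A B C h = (\<lambda>(u, r, x) (a, b, v) (a', b', v').
     - A u r x * exp (B u r x) * a * a'
     - exp (B u r x) * (a * b' + a' * b)
     + r\<^sup>2 * h u r x (v + a *\<^sub>R C u r x) (v' + a' *\<^sub>R C u r x))"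

definition metric_comp ::
  "('n event \<Rightarrow> 'n event \<Rightarrow> 'n event \<Rightarrow> real) \<Rightarrow> bool \<Rightarrow> real^('n::finite coord)
   \<Rightarrow> real^('n coord)^('n coord)" where
  "metric_comp g c z =
    (\<chi> i j. g (event_of c z) (partial i (event_of c) z) (partial j (event_of c) z))"

definition sphere_frame :: "bool \<Rightarrow> real^'n \<Rightarrow> 'n \<Rightarrow> 'n::finite ambient" where
  "sphere_frame c y I = partial I (stereo_inv c) y"

definition sphere_comp ::
  "('n ambient \<Rightarrow> 'n ambient \<Rightarrow> real) \<Rightarrow> bool \<Rightarrow> real^'n \<Rightarrow> real^'n^'n::finite" where
  "sphere_comp k c y = (\<chi> I J. k (sphere_frame c y I) (sphere_frame c y J))"

text \<open>The round metric \<open>\<omega>\<close> is the restriction of the Euclidean inner product.\<close>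

abbreviation round_comp :: "bool \<Rightarrow> real^'n \<Rightarrow> real^'n^'n::finite" where
  "round_comp \<equiv> sphere_comp inner"

definition C11_on :: "(real^'i::finite) set \<Rightarrow> (real^'i \<Rightarrow> real) \<Rightarrow> bool" where
  "C11_on D f \<longleftrightarrow>
    (\<forall>z\<in>D. f differentiable (at z)) \<and>
    (\<forall>i. \<forall>z\<in>D. \<exists>d>0. \<exists>L. L-lipschitz_on (cball z d \<inter> D) (partial i f))"

text \<open>The filter \<open>r \<rightarrow> \<infinity>\<close>, uniformly in \<open>u\<close> and in the closed hemisphere \<open>norm y \<le> 1\<close> of a
  stereographic chart. The hemispheres of the two charts cover the sphere. On a whole chart
  uniformity of tensor components would not be the right notion: there the
  components of \<open>\<omega>\<close> itself tend to \<open>0\<close> at the pole.\<close>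

definition scri :: "real set \<Rightarrow> (real^('n::finite coord)) filter" where
  "scri T = inf (filtercomap (\<lambda>z. z $ Rcoord) at_top)
                (principal {z. z $ Ucoord \<in> T \<and> norm (angles z) \<le> 1})"

text \<open>\<open>E = O(r\<^sup>p)\<close> in both charts, with term by term differentiation allowed:
  \<open>\<partial>\<^sub>r\<close> lowers the order by one, \<open>\<partial>\<^sub>u\<close> and \<open>\<partial>\<^sub>I\<close> preserve it.\<close>

definition diff_bigo :: "real set \<Rightarrow> real \<Rightarrow> real \<Rightarrow> (bool \<Rightarrow> real^('n::finite coord) \<Rightarrow> real) \<Rightarrow> bool"
  where
  "diff_bigo T R0 p E \<longleftrightarrow> (\<forall>c.
     (\<forall>z\<in>coord_region T R0. E c differentiable (at z)) \<and>
     E c \<in> O[scri T](\<lambda>z. (z $ Rcoord) powr p) \<and>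
     partial Rcoord (E c) \<in> O[scri T](\<lambda>z. (z $ Rcoord) powr (p - 1)) \<and>
     partial Ucoord (E c) \<in> O[scri T](\<lambda>z. (z $ Rcoord) powr p) \<and>
     (\<forall>I. partial (Angle I) (E c) \<in> O[scri T](\<lambda>z. (z $ Rcoord) powr p)))"


section \<open>Asymptotically flat spacetimes in Bondi coordinates\<close>

text \<open>\<open>A1\<close>, \<open>m\<close>, \<open>B1\<close>, \<open>C1\<close>, \<open>h1\<close> are the coefficients \<open>A\<^sup>(\<^sup>1\<^sup>)\<close>, \<open>m\<close>, \<open>B\<^sup>(\<^sup>1\<^sup>)\<close>, \<open>C\<^sup>(\<^sup>1\<^sup>)\<^sub>I\<close>,
  \<open>h\<^sup>(\<^sup>1\<^sup>)\<^sub>I\<^sub>J\<close> of the expansions; \<open>C\<close> is a vector field, \<open>C1\<close> a covector field and \<open>h\<close>, \<open>h1\<close> are symmetric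
  2-tensor fields on the sphere, depending on parameters. The (multi)linear forms are taken on the
  surrounding space, but only their values on tangent vectors matter. That \<open>h\<close> is positive definite on tangent
  vectors says that the metric is Lorentzian.\<close>

locale bondi_asymptotically_flat =
  fixes n :: nat
    and T :: "real set" and R0 :: real
    and A B :: "real \<Rightarrow> real \<Rightarrow> 'n::finite ambient \<Rightarrow> real"
    and C :: "real \<Rightarrow> real \<Rightarrow> 'n ambient \<Rightarrow> 'n ambient"
    and h :: "real \<Rightarrow> real \<Rightarrow> 'n ambient \<Rightarrow> 'n ambient \<Rightarrow> 'n ambient \<Rightarrow> real"
    and A1 m B1 :: "real \<Rightarrow> 'n ambient \<Rightarrow> real"
    and C1 :: "real \<Rightarrow> 'n ambient \<Rightarrow> 'n ambient \<Rightarrow> real"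
    and h1 :: "real \<Rightarrow> 'n ambient \<Rightarrow> 'n ambient \<Rightarrow> 'n ambient \<Rightarrow> real"
    and g :: "'n event \<Rightarrow> 'n event \<Rightarrow> 'n event \<Rightarrow> real"
    and N \<delta> :: real
  defines "g \<equiv> bondi_metric A B C h"
    and "N \<equiv> real n"
    and "\<delta> \<equiv> (if even n then 1 / 2 else 0)"
  assumes dimension: "n = CARD('n) + 2"
    and u_range: "open T" "is_interval T" "\<not> bdd_above T"
    and R0_nonneg: "R0 \<ge> 0"
    and C_tangent: "\<And>u r x. (u, r, x) \<in> region T R0 \<Longrightarrow> C u r x \<bullet> x = 0"
    and h_bilinear: "\<And>u r x. (u, r, x) \<in> region T R0 \<Longrightarrow> bilinear (h u r x)"
    and h_sym: "\<And>u r x v w. (u, r, x) \<in> region T R0 \<Longrightarrow> h u r x v w = h u r x w v"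
    and h_pos: "\<And>u r x v. (u, r, x) \<in> region T R0 \<Longrightarrow> v \<bullet> x = 0 \<Longrightarrow> v \<noteq> 0 \<Longrightarrow> h u r x v v > 0"
    and C1_linear: "\<And>u x. u \<in> T \<Longrightarrow> x \<in> sphere 0 1 \<Longrightarrow> linear (C1 u x)"
    and h1_bilinear: "\<And>u x. u \<in> T \<Longrightarrow> x \<in> sphere 0 1 \<Longrightarrow> bilinear (h1 u x)"
    and h1_sym: "\<And>u x v w. u \<in> T \<Longrightarrow> x \<in> sphere 0 1 \<Longrightarrow> h1 u x v w = h1 u x w v"
    and gauge: "\<And>c u r y. u \<in> T \<Longrightarrow> r > R0 \<Longrightarrow>
      sqrt (det (sphere_comp (h u r (stereo_inv c y)) c y)) = sqrt (det (round_comp c y))"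
    and regular: "\<And>c i j. C11_on (coord_region T R0) (\<lambda>z. metric_comp g c z $ i $ j)"
    and A1_bounded: "diff_bigo T R0 0 (\<lambda>c z. A1 (z $ Ucoord) (stereo_inv c (angles z)))"
    and m_bounded: "diff_bigo T R0 0 (\<lambda>c z. m (z $ Ucoord) (stereo_inv c (angles z)))"
    and B1_bounded: "diff_bigo T R0 0 (\<lambda>c z. B1 (z $ Ucoord) (stereo_inv c (angles z)))"
    and C1_bounded: "\<And>I. diff_bigo T R0 0
      (\<lambda>c z. C1 (z $ Ucoord) (stereo_inv c (angles z)) (sphere_frame c (angles z) I))"
    and h1_bounded: "\<And>I J. diff_bigo T R0 0
      (\<lambda>c z. sphere_comp (h1 (z $ Ucoord) (stereo_inv c (angles z))) c (angles z) $ I $ J)"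
    and g_uu: "diff_bigo T R0 (- (N - 1) / 2 - \<delta>) (\<lambda>c z. metric_comp g c z $ Ucoord $ Ucoord -
      (- 1 - A1 (z $ Ucoord) (stereo_inv c (angles z)) * (z $ Rcoord) powr (- (N / 2 - 1))
           + m (z $ Ucoord) (stereo_inv c (angles z)) * (z $ Rcoord) powr (- (N - 3))))"
    and g_ur: "diff_bigo T R0 (- (N - 3 / 2) - \<delta>) (\<lambda>c z. metric_comp g c z $ Ucoord $ Rcoord -
      (- 1 - B1 (z $ Ucoord) (stereo_inv c (angles z)) * (z $ Rcoord) powr (- (N - 2))))"
    and g_IJ: "\<And>I J. diff_bigo T R0 (- (N - 5) / 2 - \<delta>) (\<lambda>c z. metric_comp g c z $ Angle I $ Angle J -
      (round_comp c (angles z) $ I $ J * (z $ Rcoord)\<^sup>2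
        + sphere_comp (h1 (z $ Ucoord) (stereo_inv c (angles z))) c (angles z) $ I $ J
            * (z $ Rcoord) powr (- (N / 2 - 3))))"
    and g_uI: "\<And>I. diff_bigo T R0 (- (N - 3) / 2 - \<delta>) (\<lambda>c z. metric_comp g c z $ Ucoord $ Angle I -
      C1 (z $ Ucoord) (stereo_inv c (angles z)) (sphere_frame c (angles z) I)
        * (z $ Rcoord) powr (- (N / 2 - 2)))"


section \<open>Photons\<close>

definition christoffel ::
  "(real^'i \<Rightarrow> real^'i^'i) \<Rightarrow> real^'i \<Rightarrow> 'i \<Rightarrow> 'i \<Rightarrow> 'i::finite \<Rightarrow> real" where
  "christoffel G z k i j = (1 / 2) * (\<Sum>l\<in>UNIV. matrix_inv (G z) $ k $ l *
     (partial i (\<lambda>w. G w $ j $ l) z + partial j (\<lambda>w. G w $ i $ l) z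
      - partial l (\<lambda>w. G w $ i $ j) z))"

definition params :: "ereal \<Rightarrow> real set" where
  "params b = {s. 0 \<le> s \<and> ereal s < b}"

definition param_end :: "ereal \<Rightarrow> real filter" where
  "param_end b = filtercomap ereal (at_left b)"

definition velocity :: "(real \<Rightarrow> 'a::real_normed_vector) \<Rightarrow> ereal \<Rightarrow> real \<Rightarrow> 'a" where
  "velocity \<gamma> b s = vector_derivative \<gamma> (at s within params b)"

text \<open>Affinely parametrized geodesics on \<open>[0, b)\<close>. Continuity has to be required because of the
  junk value of the chart functions at the poles.\<close>

definition geodesic ::
  "('n event \<Rightarrow> 'n event \<Rightarrow> 'n event \<Rightarrow> real) \<Rightarrow> ereal \<Rightarrow> (real \<Rightarrow> 'n::finite event) \<Rightarrow> bool" where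
  "geodesic g b \<gamma> \<longleftrightarrow> continuous_on (params b) \<gamma> \<and>
    (\<forall>c. \<forall>s\<in>params b. \<gamma> s \<in> chart_domain c \<longrightarrow>
      (let z = (\<lambda>t. coords_of c (\<gamma> t)); z' = velocity z b; z'' = velocity z' b in
        z differentiable (at s within params b) \<and>
        z' differentiable (at s within params b) \<and>
        (\<forall>k. z'' s $ k + (\<Sum>i\<in>UNIV. \<Sum>j\<in>UNIV.
           christoffel (metric_comp g c) (z s) k i j * z' s $ i * z' s $ j) = 0)))"

text \<open>As \<open>u\<close> is a retarded time, the time orientation is the one for which the null vector field
  \<open>\<partial>\<^sub>r\<close> is future-directed; a causal vector is then future-directed iff its product with
  \<open>\<partial>\<^sub>r\<close> is negative or it is a positive multiple of \<open>\<partial>\<^sub>r\<close>.\<close>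

definition d_r :: "'n::finite event" where
  "d_r = (0, 1, 0)"

definition future_null ::
  "('n event \<Rightarrow> 'n event \<Rightarrow> 'n event \<Rightarrow> real) \<Rightarrow> 'n event \<Rightarrow> 'n::finite event \<Rightarrow> bool" where
  "future_null g p v \<longleftrightarrow> g p v v = 0 \<and> (g p v d_r < 0 \<or> (\<exists>k>0. v = k *\<^sub>R d_r))"

text \<open>A photon is followed as far as possible to the future inside the Bondi region: its worldline
  is future-inextendible there, i.e. it has no future endpoint in the region. In particular a
  photon leaving the region through \<open>r = R0\<close> is included (and does not reach infinity).\<close>

definition photon ::
  "real set \<Rightarrow> real \<Rightarrow> ('n event \<Rightarrow> 'n event \<Rightarrow> 'n event \<Rightarrow> real) \<Rightarrow> ereal \<Rightarrow>
   (real \<Rightarrow> 'n::finite event) \<Rightarrow> bool" where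
  "photon T R0 g b \<gamma> \<longleftrightarrow> 0 < b \<and> \<gamma> ` params b \<subseteq> region T R0 \<and> geodesic g b \<gamma> \<and>
    (\<forall>s\<in>params b. future_null g (\<gamma> s) (velocity \<gamma> b s)) \<and>
    \<not> (\<exists>p\<in>region T R0. (\<gamma> \<longlongrightarrow> p) (param_end b))"

definition u_of :: "'n::finite event \<Rightarrow> real" where "u_of = (\<lambda>(u, r, x). u)"
definition r_of :: "'n::finite event \<Rightarrow> real" where "r_of = (\<lambda>(u, r, x). r)"

definition rdot :: "ereal \<Rightarrow> (real \<Rightarrow> 'n::finite event) \<Rightarrow> real \<Rightarrow> real" where
  "rdot b \<gamma> s = velocity (r_of \<circ> \<gamma>) b s / velocity (u_of \<circ> \<gamma>) b s"

definition reaches_scri :: "ereal \<Rightarrow> (real \<Rightarrow> 'n::finite event) \<Rightarrow> bool" where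
  "reaches_scri b \<gamma> \<longleftrightarrow>
    filterlim (r_of \<circ> \<gamma>) at_top (param_end b) \<and> bounded ((u_of \<circ> \<gamma>) ` params b)"

definition rdot_crit :: real where
  "rdot_crit = - (1 - 1 / sqrt 3)"


end

(* Write q = -g(v, d_r) and e = -g(v, d_u) for the two lowered velocity components of a photon; in
   Minkowski space q = u' and e = u' + r'.  Lowering the index turns the geodesic equation into
   d/ds g(v, d_l) = (1/2) (d_l g_ij) v^i v^j, so only derivatives of the metric along u and r matter.
   By the null condition r |x'| is controlled by u' and r', and for large r the quotient
   Q = e / q ~ 1 + dr/du satisfies, with relative errors tending to 0,
     r dQ/du = Q (2 Q - 1),   dr/du = Q - 1.
   A photon with dr/du >= rdot_crit starts with Q > 0.56 > 1/2. As long as r stays large, Q increases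
   and so does ln r - 3/Q, hence r never drops below a fixed fraction of its initial value and the
   estimates persist.  Moreover u/2 + r/Q decreases, so u stays bounded.  If Q were bounded, the whole
   worldline would have length controlled by u and would converge to a point of the region,
   contradicting inextendibility; so Q is unbounded, and r^5 / Q is eventually increasing, which
   forces r to infinity. *)

theory Submission
  imports Defs
begin

section \<open>Term by term differentiable Landau symbols\<close>

text \<open>The coordinate fields along u and r are the same in both stereographic charts, so q and
  e are global along the worldline, and at each point the metric may be estimated in the chart whose
  unit ball contains that point; only there are the asymptotics uniform. Angular derivatives of the
  metric are of order \<open>r\<^sup>2\<close> even in flat space, and the lowered equations for u
  and r never meet them. In Minkowski space e is the conserved energy and r q' = -(r |x'|)^2, which
  the null condition turns into -(u'^2 + 2 u' r'); dividing by q gives Q (2 Q - 1). Its zero Q = 1/2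
  is the radially ingoing ray. The critical value is Q = 1/sqrt 3 > 0.577; the gap down to 0.56
  absorbs the metric errors in q and e. The dimension enters through r times the u-derivative of the
  metric: differentiation in u does not improve the order of the leading terms, so this product is
  small only if n/2 - 1 > 1. All errors are relative, so one fixed accuracy 1/30000 suffices. The
  remaining circularity is that Q makes sense only for q > 0, while a limit of good parameters
  yields just q \<ge> 0; a Gronwall argument closes this gap.\<close>

lemma partial_eq: "(f has_derivative f') (at z) \<Longrightarrow> partial i f z = f' (axis i 1)"
  unfolding partial_def using frechet_derivative_at by metis

lemma has_derivative_partials:
  assumes "f differentiable (at z)"
  shows "(f has_derivative (\<lambda>v. \<Sum>j\<in>UNIV. v $ j *\<^sub>R partial j f z)) (at z)"
proof -
  let ?D = "frechet_derivative f (at z)"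
  have D: "(f has_derivative ?D) (at z)"
    using assms frechet_derivative_works by blast
  then have "linear ?D"
    by (rule has_derivative_linear)
  then have "?D v = (\<Sum>j\<in>UNIV. v $ j *\<^sub>R partial j f z)" for v
    by (subst basis_expansion[symmetric, of v])
      (simp add: linear_sum linear_cmul partial_def scalar_mult_eq_scaleR)
  then have "?D = (\<lambda>v. \<Sum>j\<in>UNIV. v $ j *\<^sub>R partial j f z)" by blast
  then show ?thesis using D by simp
qed

lemma has_frechet_derivative:
  "f differentiable F \<Longrightarrow> (f has_derivative frechet_derivative f F) F"
  by (simp add: frechet_derivative_works)

lemma partial_add:
  assumes "f differentiable (at z)" "g differentiable (at z)"
  shows "partial i (\<lambda>z. f z + g z) z = partial i f z + partial i g z"
  by (simp add: partial_eq[OF has_derivative_add[OF has_frechet_derivative has_frechet_derivative, OF assms]])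
    (simp add: partial_def)

lemma partial_mult:
  fixes f g :: "real^'i::finite \<Rightarrow> real"
  assumes "f differentiable (at z)" "g differentiable (at z)"
  shows "partial i (\<lambda>z. f z * g z) z = f z * partial i g z + partial i f z * g z"
  by (simp add: partial_eq[OF has_derivative_mult[OF has_frechet_derivative has_frechet_derivative, OF assms]])
    (simp add: partial_def)

lemma eventually_scri:
  "eventually P (scri T) \<longleftrightarrow>
    (\<exists>M. \<forall>z. z $ Rcoord \<ge> M \<longrightarrow> z $ Ucoord \<in> T \<longrightarrow> norm (angles z) \<le> 1 \<longrightarrow> P z)"
  unfolding scri_def eventually_inf_principal eventually_filtercomap_at_top_linorder
  by auto

lemma eventually_scri_region: "eventually (\<lambda>z. z \<in> coord_region T R0) (scri T)"
  unfolding eventually_scri coord_region_def by (rule exI[of _ "R0 + 1"]) auto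

lemma bigo_powr_mono_scri:
  "p \<le> q \<Longrightarrow> (\<lambda>z. (z $ Rcoord) powr p) \<in> O[scri T](\<lambda>z. (z $ Rcoord) powr q)"
  by (rule landau_o.big_mono)
    (auto simp: eventually_scri intro!: exI[of _ 1] powr_mono)

text \<open>The strict gap between the exponents pays for the unknown Landau constant:
  \<open>r powr (p - q)\<close> tends to 0 and eventually drops below
  \<open>\<eta> / K\<close>.\<close>

lemma bigo_scri_imp_small:
  assumes "f \<in> O[scri T](\<lambda>z. (z $ Rcoord) powr p)" "p < q" "\<eta> > 0"
  shows "eventually (\<lambda>z. \<bar>f z\<bar> \<le> \<eta> * (z $ Rcoord) powr q) (scri T)"
proof -
  obtain K where K: "K > 0" "eventually (\<lambda>z. norm (f z) \<le> K * norm ((z $ Rcoord) powr p)) (scri T)"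
    using assms(1) by (rule landau_o.bigE)
  have "((\<lambda>r::real. r powr (p - q)) \<longlongrightarrow> 0) at_top"
    using assms(2) by (intro tendsto_neg_powr filterlim_ident) auto
  then have "eventually (\<lambda>r::real. r powr (p - q) < \<eta> / K \<and> r > 0) at_top"
    using K assms(3) by (intro eventually_conj order_tendstoD eventually_gt_at_top) auto
  then obtain M where M: "\<And>r. r \<ge> M \<Longrightarrow> r powr (p - q) < \<eta> / K \<and> r > (0::real)"
    by (auto simp: eventually_at_top_linorder)
  have "eventually (\<lambda>z. z $ Rcoord \<ge> M) (scri T)"
    by (auto simp: eventually_scri)
  with K(2) show ?thesis
  proof eventually_elim
    case (elim z)
    let ?r = "z $ Rcoord"
    have "?r powr p = ?r powr (p - q) * ?r powr q"
      by (simp add: powr_add[symmetric])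
    moreover have "K * ?r powr (p - q) \<le> \<eta>"
      using M[OF elim(2)] K(1) by (auto simp: field_simps)
    ultimately have "K * ?r powr p \<le> \<eta> * ?r powr q"
      by (metis mult.assoc mult_right_mono powr_ge_zero)
    then show ?case using elim(1) by simp
  qed
qed

text \<open>Puts the three derivative clauses of \<open>diff_bigo\<close> into one, so that sums and
  products need no case distinction on the direction.\<close>

definition order_drop :: "'n coord \<Rightarrow> real" where
  "order_drop i = (if i = Rcoord then 1 else 0)"

lemma diff_bigo_iff:
  "diff_bigo T R0 p E \<longleftrightarrow> (\<forall>c.
     (\<forall>z\<in>coord_region T R0. E c differentiable (at z)) \<and>
     E c \<in> O[scri T](\<lambda>z. (z $ Rcoord) powr p) \<and>
     (\<forall>i. partial i (E c) \<in> O[scri T](\<lambda>z. (z $ Rcoord) powr (p - order_drop i))))"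
proof -
  have *: "(\<forall>i. P i) \<longleftrightarrow> P Rcoord \<and> P Ucoord \<and> (\<forall>I. P (Angle I))" for P :: "'a coord \<Rightarrow> bool"
    by (metis coord.exhaust)
  show ?thesis
    unfolding diff_bigo_def * by (simp add: order_drop_def)
qed

section \<open>Algebra of differentiable Landau symbols\<close>

lemma diff_bigo_mono:
  assumes "diff_bigo T R0 p E" "p \<le> q"
  shows "diff_bigo T R0 q E"
proof -
  have "O[scri T](\<lambda>z::real^('a coord). (z $ Rcoord) powr (p - k)) \<subseteq> O[scri T](\<lambda>z. (z $ Rcoord) powr (q - k))" for k
    using assms(2) by (intro landau_o.big_subsetI bigo_powr_mono_scri) simp
  from this[of 0] this show ?thesis
    using assms(1) unfolding diff_bigo_iff by (simp add: subset_iff)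
qed

lemma diff_bigo_add:
  assumes "diff_bigo T R0 p E" "diff_bigo T R0 p F"
  shows "diff_bigo T R0 p (\<lambda>c z. E c z + F c z)"
  unfolding diff_bigo_iff
proof (intro allI conjI ballI)
  fix c i
  have d: "E c differentiable (at z)" "F c differentiable (at z)" if "z \<in> coord_region T R0" for z
    using assms that by (auto simp: diff_bigo_iff)
  show "(\<lambda>z. E c z + F c z) differentiable (at z)" if "z \<in> coord_region T R0" for z
    using d that by auto
  show "(\<lambda>z. E c z + F c z) \<in> O[scri T](\<lambda>z. (z $ Rcoord) powr p)"
    using assms by (auto simp: diff_bigo_iff intro!: sum_in_bigo)
  have "(\<lambda>z. partial i (E c) z + partial i (F c) z) \<in> O[scri T](\<lambda>z. (z $ Rcoord) powr (p - order_drop i))"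
    using assms by (auto simp: diff_bigo_iff intro!: sum_in_bigo)
  moreover have "eventually (\<lambda>z. partial i (E c) z + partial i (F c) z = partial i (\<lambda>z. E c z + F c z) z) (scri T)"
    using eventually_scri_region[of T R0] by eventually_elim (rule partial_add[OF d, symmetric])
  ultimately show "partial i (\<lambda>z. E c z + F c z) \<in> O[scri T](\<lambda>z. (z $ Rcoord) powr (p - order_drop i))"
    by (rule landau_o.big.in_cong[THEN iffD1, rotated])
qed

lemma diff_bigo_mult:
  assumes "diff_bigo T R0 p E" "diff_bigo T R0 q F"
  shows "diff_bigo T R0 (p + q) (\<lambda>c z. E c z * F c z)"
  unfolding diff_bigo_iff
proof (intro allI conjI ballI)
  fix c i
  have d: "E c differentiable (at z)" "F c differentiable (at z)" if "z \<in> coord_region T R0" for z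
    using assms that by (auto simp: diff_bigo_iff)
  show "(\<lambda>z. E c z * F c z) differentiable (at z)" if "z \<in> coord_region T R0" for z
    using d that by auto
  have E: "E c \<in> O[scri T](\<lambda>z. (z $ Rcoord) powr p)"
    "partial i (E c) \<in> O[scri T](\<lambda>z. (z $ Rcoord) powr (p - order_drop i))"
    using assms by (auto simp: diff_bigo_iff)
  have F: "F c \<in> O[scri T](\<lambda>z. (z $ Rcoord) powr q)"
    "partial i (F c) \<in> O[scri T](\<lambda>z. (z $ Rcoord) powr (q - order_drop i))"
    using assms by (auto simp: diff_bigo_iff)
  show "(\<lambda>z. E c z * F c z) \<in> O[scri T](\<lambda>z. (z $ Rcoord) powr (p + q))"
    using landau_o.big.mult[OF E(1) F(1)] unfolding powr_add .
  have exps: "p + (q - order_drop i) = p + q - order_drop i" "p - order_drop i + q = p + q - order_drop i"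
    by simp_all
  have "(\<lambda>z. E c z * partial i (F c) z + partial i (E c) z * F c z)
      \<in> O[scri T](\<lambda>z. (z $ Rcoord) powr (p + q - order_drop i))"
    using landau_o.big.mult[OF E(1) F(2)] landau_o.big.mult[OF E(2) F(1)]
    unfolding powr_add[symmetric] exps by (rule sum_in_bigo)
  moreover have "eventually (\<lambda>z. E c z * partial i (F c) z + partial i (E c) z * F c z
      = partial i (\<lambda>z. E c z * F c z) z) (scri T)"
    using eventually_scri_region[of T R0] by eventually_elim (rule partial_mult[OF d, symmetric])
  ultimately show "partial i (\<lambda>z. E c z * F c z) \<in> O[scri T](\<lambda>z. (z $ Rcoord) powr (p + q - order_drop i))"
    by (rule landau_o.big.in_cong[THEN iffD1, rotated])
qed

lemma has_derivative_Rcoord_powr: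
  fixes z :: "real^('n::finite coord)"
  assumes "z $ Rcoord > 0"
  shows "((\<lambda>z. (z $ Rcoord) powr p) has_derivative
    (\<lambda>v. p * (z $ Rcoord) powr (p - 1) * v $ Rcoord)) (at z)"
proof -
  have "((\<lambda>t::real. t powr p) has_real_derivative p * (z $ Rcoord) powr (p - 1)) (at (z $ Rcoord))"
    using assms by (rule has_real_derivative_powr)
  then show ?thesis
    unfolding has_field_derivative_def
    by (rule has_derivative_compose[rotated])
      (rule bounded_linear_imp_has_derivative[OF bounded_linear_vec_nth])
qed

lemma diff_bigo_powr:
  assumes "R0 \<ge> 0"
  shows "diff_bigo T R0 p (\<lambda>c z. (z $ Rcoord) powr p)"
  unfolding diff_bigo_iff
proof (intro allI conjI ballI)
  fix i :: "'a coord"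
  show "(\<lambda>z. (z $ Rcoord) powr p) differentiable (at z)" if "z \<in> coord_region T R0" for z :: "real^('a coord)"
    using that assms has_derivative_Rcoord_powr[of z p] by (auto simp: coord_region_def differentiable_def)
  have "(\<lambda>z. p * axis i 1 $ Rcoord * (z $ Rcoord) powr (p - 1))
      \<in> O[scri T](\<lambda>z. (z $ Rcoord) powr (p - order_drop i))"
  proof (cases "i = Rcoord")
    case True
    then show ?thesis by (simp add: order_drop_def)
  next
    case False
    then show ?thesis by (simp add: axis_def)
  qed
  moreover have "eventually (\<lambda>z. p * axis i 1 $ Rcoord * (z $ Rcoord) powr (p - 1)
      = partial i (\<lambda>z. (z $ Rcoord) powr p) z) (scri T)"
    using eventually_scri_region[of T R0] by eventually_elim
      (use assms in \<open>auto simp: coord_region_def partial_eq[OF has_derivative_Rcoord_powr]\<close>)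
  ultimately show "partial i (\<lambda>z. (z $ Rcoord) powr p) \<in> O[scri T](\<lambda>z. (z $ Rcoord) powr (p - order_drop i))"
    by (rule landau_o.big.in_cong[THEN iffD1, rotated])
qed simp

lemma diff_bigo_scale:
  fixes E :: "bool \<Rightarrow> real^('n::finite coord) \<Rightarrow> real"
  assumes "diff_bigo T R0 p E"
  shows "diff_bigo T R0 p (\<lambda>c z. k * E c z)"
proof -
  have "diff_bigo T R0 0 (\<lambda>c z :: real^('n coord). k)"
    unfolding diff_bigo_iff
    by (auto simp: partial_eq[OF has_derivative_const] eventually_scri
        intro!: bigoI[of _ "\<bar>k\<bar>"] exI[of _ 1])
  from diff_bigo_mult[OF this assms] show ?thesis by simp
qed

text \<open>Absorbs the last coefficient term of an expansion into the error; applied repeatedly, it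
  reduces an expansion to its flat part.\<close>

lemma diff_bigo_diff_powr:
  assumes "R0 \<ge> 0" "diff_bigo T R0 p (\<lambda>c z. E c z - (F c z + H c z * (z $ Rcoord) powr q))"
    "diff_bigo T R0 0 H" "p \<le> s" "q \<le> s"
  shows "diff_bigo T R0 s (\<lambda>c z. E c z - F c z)"
  using diff_bigo_add[OF diff_bigo_mono[OF assms(2,4)]
      diff_bigo_mono[OF diff_bigo_mult[OF assms(3) diff_bigo_powr[OF assms(1), of T q]]]] assms(5)
  by (simp add: algebra_simps)

section \<open>Stereographic charts\<close>

lemma UNIV_coord: "(UNIV :: 'n coord set) = insert Ucoord (insert Rcoord (range Angle))"
  by (auto intro: coord.exhaust)

lemma sum_coord:
  "(\<Sum>i\<in>UNIV. f i) = f Ucoord + f Rcoord + (\<Sum>I\<in>UNIV. f (Angle I))"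
  for f :: "'n::finite coord \<Rightarrow> 'a::ab_group_add"
proof -
  have "inj (Angle :: 'n \<Rightarrow> 'n coord)" by (simp add: inj_on_def)
  then show ?thesis
    unfolding UNIV_coord by (subst sum.insert, simp, force)+ (simp add: sum.reindex add.assoc)
qed

lemma pole_sq: "pole c * pole c = 1" "(pole c)\<^sup>2 = 1" "pole c * (pole c * t) = t"
  by (auto simp: pole_def)

text \<open>The differential of \<open>stereo_inv c\<close> at \<open>y\<close>, applied to
  \<open>w\<close>.\<close>

definition dstereo :: "bool \<Rightarrow> real^'n \<Rightarrow> real^'n \<Rightarrow> 'n::finite ambient" where
  "dstereo c y w = (pole c * 4 * (y \<bullet> w) / (y \<bullet> y + 1)\<^sup>2,
    (2 / (y \<bullet> y + 1)) *\<^sub>R w - (4 * (y \<bullet> w) / (y \<bullet> y + 1)\<^sup>2) *\<^sub>R y)"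

lemma inner_self_plus_1: "y \<bullet> y + 1 > 0" "y \<bullet> y + 1 \<noteq> 0" for y :: "'a::real_inner"
  by (simp_all add: add_nonneg_pos less_imp_neq[symmetric])

lemma stereo_inv_inner:
  "stereo_inv c y = (pole c * (y \<bullet> y - 1) / (y \<bullet> y + 1), (2 / (y \<bullet> y + 1)) *\<^sub>R y)"
  by (simp add: stereo_inv_def power2_norm_eq_inner)

lemma has_derivative_stereo_inv: "(stereo_inv c has_derivative dstereo c y) (at y)"
proof -
  have "((\<lambda>y. (pole c * (y \<bullet> y - 1) / (y \<bullet> y + 1), (2 / (y \<bullet> y + 1)) *\<^sub>R y)) has_derivative dstereo c y) (at y)"
    unfolding dstereo_def[abs_def]
    by (rule derivative_eq_intros refl inner_self_plus_1)+
      (use inner_self_plus_1[of y] in \<open>auto simp: fun_eq_iff inner_commute field_simps power2_eq_square scaleR_left_distrib[symmetric] scaleR_diff_left\<close>)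
  then show ?thesis by (simp add: stereo_inv_inner[abs_def])
qed

lemma linear_dstereo: "linear (dstereo c y)"
  using has_derivative_stereo_inv has_derivative_linear by blast

text \<open>Stereographic projection is conformal. With k = |y|^2 + 1 the terms in (y v)(y w) have
  coefficients 16/k^4, -16/k^3 and 16(k - 1)/k^4, which cancel.\<close>

lemma inner_dstereo: "dstereo c y v \<bullet> dstereo c y w = (2 / (y \<bullet> y + 1))\<^sup>2 * (v \<bullet> w)"
proof -
  define k where "k = y \<bullet> y + 1"
  have k: "k \<noteq> 0" "y \<bullet> y = k - 1" using inner_self_plus_1[of y] by (auto simp: k_def)
  have "dstereo c y v \<bullet> dstereo c y w =
    16 * (y \<bullet> v) * (y \<bullet> w) / k^4 + ((4 / k\<^sup>2) * (v \<bullet> w) - 2 * (8 * (y \<bullet> v) * (y \<bullet> w) / k^3)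
      + 16 * (y \<bullet> v) * (y \<bullet> w) * (k - 1) / k^4)"
    unfolding dstereo_def k_def[symmetric] inner_Pair inner_diff_left inner_diff_right
      inner_scaleR_left inner_scaleR_right k(2) inner_commute[of v y] inner_commute[of w y]
    using k(1) pole_sq[of c] by (simp add: field_simps power_numeral_reduce)
  also have "\<dots> = (2 / k)\<^sup>2 * (v \<bullet> w)"
    using k(1) by (simp add: field_simps power_numeral_reduce)
  finally show ?thesis by (simp add: k_def)
qed

lemma norm_dstereo: "norm (dstereo c y w) = 2 / (y \<bullet> y + 1) * norm w"
proof -
  have "norm (dstereo c y w) = sqrt ((2 / (y \<bullet> y + 1))\<^sup>2 * (norm w)\<^sup>2)"
    by (simp add: norm_eq_sqrt_inner inner_dstereo power2_norm_eq_inner)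
  then show ?thesis using inner_self_plus_1(1)[of y] by (simp add: real_sqrt_mult)
qed

lemma stereo_inv_orthogonal_dstereo: "dstereo c y w \<bullet> stereo_inv c y = 0"
proof -
  define k where "k = y \<bullet> y + 1"
  have k: "k \<noteq> 0" "y \<bullet> y = k - 1" using inner_self_plus_1[of y] by (auto simp: k_def)
  show ?thesis
    unfolding dstereo_def stereo_inv_inner k_def[symmetric] inner_Pair inner_diff_left
      inner_scaleR_left inner_scaleR_right k(2) inner_commute[of w y]
    using k(1) by (simp add: field_simps power_numeral_reduce pole_sq)
qed

lemma stereo_inv_in_sphere: "stereo_inv c y \<in> sphere 0 1"
proof -
  define k where "k = y \<bullet> y + 1"
  have k: "k \<noteq> 0" "y \<bullet> y = k - 1" using inner_self_plus_1[of y] by (auto simp: k_def)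
  have "stereo_inv c y \<bullet> stereo_inv c y = 1"
    unfolding stereo_inv_inner k_def[symmetric] inner_Pair inner_scaleR_left inner_scaleR_right k(2)
    using k(1) pole_sq[of c] by (simp add: field_simps power_numeral_reduce)
  then show ?thesis by (simp add: norm_eq_sqrt_inner)
qed

lemma sphere_frame_eq: "sphere_frame c y I = dstereo c y (axis I 1)"
  unfolding sphere_frame_def by (rule partial_eq[OF has_derivative_stereo_inv])

lemma dstereo_eq_sum: "dstereo c y w = (\<Sum>I\<in>UNIV. w $ I *\<^sub>R sphere_frame c y I)"
  by (subst basis_expansion[symmetric, of w])
    (simp add: sphere_frame_eq linear_sum[OF linear_dstereo] linear_cmul[OF linear_dstereo] scalar_mult_eq_scaleR)

lemma stereo_norm_sq:
  assumes "x \<in> sphere 0 1" "x \<noteq> (pole c, 0)"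
  shows "stereo c x \<bullet> stereo c x = (1 + pole c * fst x) / (1 - pole c * fst x)"
    and "1 - pole c * fst x > 0"
proof -
  define t where "t = pole c * fst x"
  obtain x1 x2 where x: "x = (x1, x2)" by (cases x)
  have "x \<bullet> x = 1" using assms(1) by (simp add: norm_eq_sqrt_inner)
  moreover have "fst x = pole c * t" using pole_sq[of c] by (simp add: t_def mult.assoc[symmetric])
  ultimately have sq: "snd x \<bullet> snd x = 1 - t\<^sup>2"
    using pole_sq[of c] by (cases x) (simp add: inner_Pair power2_eq_square mult_ac)
  then have "t\<^sup>2 \<le> 1" by (metis diff_ge_0_iff_ge inner_ge_zero)
  then have "t \<le> 1" by (simp add: abs_square_le_1)
  moreover have "t \<noteq> 1"
    using sq assms(2) \<open>fst x = pole c * t\<close> by (cases x) auto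
  ultimately have t: "1 - t > 0" by simp
  then show "1 - pole c * fst x > 0" by (simp add: t_def)
  have "stereo c x \<bullet> stereo c x = (1 - t\<^sup>2) / (1 - t)\<^sup>2"
    by (simp add: stereo_def t_def[symmetric] sq power2_eq_square)
  also have "\<dots> = (1 + t) / (1 - t)" using t by (simp add: divide_simps power2_eq_square) (simp add: algebra_simps)
  finally show "stereo c x \<bullet> stereo c x = (1 + pole c * fst x) / (1 - pole c * fst x)" by (simp add: t_def)
qed

lemma stereo_inv_stereo:
  assumes "x \<in> sphere 0 1" "x \<noteq> (pole c, 0)"
  shows "stereo_inv c (stereo c x) = x"
proof -
  define t where "t = pole c * fst x"
  have t: "1 - t > 0" using stereo_norm_sq(2)[OF assms] by (simp add: t_def)
  have n: "stereo c x \<bullet> stereo c x = (1 + t) / (1 - t)" using stereo_norm_sq(1)[OF assms] by (simp add: t_def)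
  have "(1 + t) / (1 - t) + 1 = 2 / (1 - t)" "(1 + t) / (1 - t) - 1 = 2 * t / (1 - t)"
    using t by (simp_all add: divide_simps)
  moreover have "fst x = pole c * t" using pole_sq[of c] by (simp add: t_def mult.assoc[symmetric])
  ultimately show ?thesis
    using t unfolding stereo_inv_inner n
    by (cases x) (simp add: stereo_def t_def[symmetric] pole_sq)
qed

text \<open>The closed hemisphere opposite the projection pole goes to the unit ball, the set on
  which \<open>scri\<close> is uniform. Together with \<open>hemisphere_chart_exists\<close> this
  gives every point a usable chart.\<close>

lemma norm_stereo_le_1:
  assumes "x \<in> sphere 0 1" "pole c * fst x \<le> 0"
  shows "x \<noteq> (pole c, 0)" "norm (stereo c x) \<le> 1"
proof -
  show ne: "x \<noteq> (pole c, 0)" using assms(2) pole_sq[of c] by auto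
  have "stereo c x \<bullet> stereo c x \<le> 1"
    unfolding stereo_norm_sq(1)[OF assms(1) ne]
    using stereo_norm_sq(2)[OF assms(1) ne] assms(2) by (simp add: divide_simps)
  then show "norm (stereo c x) \<le> 1" by (simp add: norm_eq_sqrt_inner)
qed

lemma hemisphere_chart_exists: "\<exists>c. pole c * fst x \<le> 0"
  by (cases "fst x \<le> 0") (auto intro: exI[of _ True] exI[of _ False] simp: pole_def)

lemma bounded_linear_angles: "bounded_linear angles"
  by (rule linear_conv_bounded_linear[THEN iffD1])
    (auto intro!: linearI simp: angles_def vec_eq_iff)

lemma has_derivative_event_of:
  "(event_of c has_derivative (\<lambda>v. (v $ Ucoord, v $ Rcoord, dstereo c (angles z) (angles v)))) (at z)"
  unfolding event_of_def[abs_def]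
  by (intro has_derivative_Pair bounded_linear_imp_has_derivative bounded_linear_vec_nth
      has_derivative_compose[OF bounded_linear_imp_has_derivative[OF bounded_linear_angles] has_derivative_stereo_inv])

lemma angles_axis: "angles (axis (Angle I) 1) = axis I 1" "angles (axis Ucoord 1) = 0" "angles (axis Rcoord 1) = 0"
  by (auto simp: angles_def axis_def vec_eq_iff)

lemma partial_event_of:
  "partial Ucoord (event_of c) z = (1, 0, 0)"
  "partial Rcoord (event_of c) z = (0, 1, 0)"
  "partial (Angle I) (event_of c) z = (0, 0, sphere_frame c (angles z) I)"
  using linear_0[OF linear_dstereo]
  by (simp_all add: partial_eq[OF has_derivative_event_of] angles_axis sphere_frame_eq)
    (simp_all add: axis_def zero_prod_def)

lemma coords_of_nth [simp]:
  "coords_of c (u, r, x) $ Ucoord = u" "coords_of c (u, r, x) $ Rcoord = r"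
  "angles (coords_of c (u, r, x)) = stereo c x"
  by (simp_all add: coords_of_def angles_def vec_eq_iff)

lemma event_of_coords_of:
  assumes "p \<in> region T R0" "p \<in> chart_domain c"
  shows "event_of c (coords_of c p) = p"
  using assms by (cases p) (auto simp: region_def chart_domain_def event_of_def angles_def[symmetric] stereo_inv_stereo)

lemma coords_of_in_coord_region:
  "p \<in> region T R0 \<Longrightarrow> coords_of c p \<in> coord_region T R0"
  by (cases p) (simp add: region_def coord_region_def)

lemma event_of_in_region: "z \<in> coord_region T R0 \<Longrightarrow> event_of c z \<in> region T R0"
  using stereo_inv_in_sphere by (simp add: region_def coord_region_def event_of_def)

lemma open_chart_domain: "open (chart_domain c :: 'n::finite event set)"
proof -
  have "open ((\<lambda>p. snd (snd p)) -` (- {(pole c, 0)}) :: 'n event set)"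
    by (rule open_vimage) (auto intro!: continuous_intros)
  also have "(\<lambda>p. snd (snd p)) -` (- {(pole c, 0)}) = (chart_domain c :: 'n event set)"
    by (auto simp: chart_domain_def)
  finally show ?thesis .
qed

section \<open>Null vectors of a nearly flat metric\<close>

text \<open>Here \<open>a = u'\<close>, \<open>b = r'\<close> and \<open>Y = r |x'|\<close>. The letters \<open>g\<close>, \<open>k\<close>, \<open>l\<close> stand for the metric, \<open>r \<partial>\<^sub>r\<close> of it and
  \<open>r \<partial>\<^sub>u\<close> of it; the suffixes \<open>u\<close>, \<open>h\<close> denote the mixed and the angular components contracted with \<open>x'\<close>.
  Accordingly \<open>dq\<close> and \<open>de\<close> are \<open>r q'\<close> and \<open>r e'\<close>. In Minkowski space \<open>g\<^sub>h = Y\<^sup>2\<close> and \<open>k\<^sub>h = 2 Y\<^sup>2\<close>.\<close>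

locale perturbed_null =
  fixes \<eta> a b Y guu gur gu gh kuu kur ku kh luu lur lu lh dq de q e :: real
  assumes eta: "0 \<le> \<eta>" "\<eta> \<le> 1/30000"
    and nonneg: "0 \<le> a" "0 \<le> Y"
    and g: "\<bar>guu + 1\<bar> \<le> \<eta>" "\<bar>gur + 1\<bar> \<le> \<eta>" "\<bar>gu\<bar> \<le> \<eta> * Y" "\<bar>gh - Y\<^sup>2\<bar> \<le> \<eta> * Y\<^sup>2"
    and k: "\<bar>kuu\<bar> \<le> \<eta>" "\<bar>kur\<bar> \<le> \<eta>" "\<bar>ku\<bar> \<le> \<eta> * Y" "\<bar>kh - 2 * Y\<^sup>2\<bar> \<le> \<eta> * Y\<^sup>2"
    and l: "\<bar>luu\<bar> \<le> \<eta>" "\<bar>lur\<bar> \<le> \<eta>" "\<bar>lu\<bar> \<le> \<eta> * Y" "\<bar>lh\<bar> \<le> \<eta> * Y\<^sup>2"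
    and null: "guu * a\<^sup>2 + 2 * gur * a * b + 2 * a * gu + gh = 0"
    and q_eq: "q = - (gur * a)"
    and e_eq: "e = - (guu * a + gur * b + gu)"
    and dq_eq: "2 * dq = - (kuu * a\<^sup>2 + 2 * kur * a * b + 2 * a * ku + kh)"
    and de_eq: "2 * de = - (luu * a\<^sup>2 + 2 * lur * a * b + 2 * a * lu + lh)"
begin

lemma abs_quadratic_le:
  assumes "\<bar>c0\<bar> \<le> \<eta>" "\<bar>c1\<bar> \<le> \<eta>" "\<bar>c2\<bar> \<le> \<eta> * Y"
  shows "\<bar>c0 * a\<^sup>2 + 2 * c1 * a * b + 2 * a * c2\<bar> \<le> \<eta> * (a\<^sup>2 + 2 * a * \<bar>b\<bar> + 2 * a * Y)"
proof -
  have "\<bar>c0 * a\<^sup>2\<bar> \<le> \<eta> * a\<^sup>2" "\<bar>2 * c1 * a * b\<bar> \<le> \<eta> * (2 * a * \<bar>b\<bar>)" "\<bar>2 * a * c2\<bar> \<le> \<eta> * (2 * a * Y)"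
    using mult_right_mono[OF assms(1), of "a\<^sup>2"] mult_right_mono[OF assms(2), of "2 * a * \<bar>b\<bar>"]
      mult_left_mono[OF assms(3), of "2 * a"] nonneg
    by (simp_all add: abs_mult algebra_simps)
  then show ?thesis by (simp add: algebra_simps)
qed

abbreviation "M \<equiv> a + \<bar>b\<bar>"

text \<open>An a priori bound is needed first because the error terms of the null condition contain
  \<open>Y\<close> themselves; 2 a Y \<le> a^2 + Y^2 lets the small multiple of
  \<open>Y\<^sup>2\<close> be absorbed on the left.\<close>

lemma Y_sq_le: "Y\<^sup>2 \<le> 3 * a * M"
proof -
  have "\<bar>(guu + 1) * a\<^sup>2 + 2 * (gur + 1) * a * b + 2 * a * gu\<bar> \<le> \<eta> * (a\<^sup>2 + 2 * a * \<bar>b\<bar> + 2 * a * Y)"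
    by (rule abs_quadratic_le) (use g in auto)
  moreover have "(guu + 1) * a\<^sup>2 + 2 * (gur + 1) * a * b + 2 * a * gu = a\<^sup>2 + 2 * a * b - gh"
    using null by (simp add: algebra_simps)
  ultimately have "gh \<le> a\<^sup>2 + 2 * a * b + \<eta> * (a\<^sup>2 + 2 * a * \<bar>b\<bar> + 2 * a * Y)" by linarith
  moreover have "2 * a * Y \<le> a\<^sup>2 + Y\<^sup>2"
    by (rule sum_squares_bound)
  then have "\<eta> * (a\<^sup>2 + 2 * a * \<bar>b\<bar> + 2 * a * Y) \<le> 1/30000 * (2 * a\<^sup>2 + 2 * a * \<bar>b\<bar> + Y\<^sup>2)"
    using eta nonneg by (intro mult_mono) auto
  moreover have "\<eta> * Y\<^sup>2 \<le> 1/30000 * Y\<^sup>2" using eta by (intro mult_right_mono) auto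
  moreover have "a * b \<le> a * \<bar>b\<bar>" using nonneg by (intro mult_left_mono) auto
  moreover have "0 \<le> a * \<bar>b\<bar>" "0 \<le> a\<^sup>2" using nonneg by auto
  ultimately show ?thesis
    using g(4) by (simp only: power2_eq_square algebra_simps)
qed

lemma Y_le: "Y \<le> 2 * M"
proof -
  have "3 * a * M \<le> 3 * M * M" using nonneg by (intro mult_right_mono) auto
  also have "\<dots> \<le> (2 * M)\<^sup>2" using zero_le_square[of M] by (simp only: power2_eq_square algebra_simps)
  finally have "Y\<^sup>2 \<le> (2 * M)\<^sup>2" using Y_sq_le by linarith
  then show ?thesis using nonneg power2_le_imp_le by fastforce
qed

lemma quadratic_le: "\<eta> * (a\<^sup>2 + 2 * a * \<bar>b\<bar> + 2 * a * Y) \<le> 6 * \<eta> * a * M"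
proof -
  have "a * Y \<le> a * (2 * M)" using Y_le nonneg by (intro mult_left_mono) auto
  moreover have "0 \<le> a * \<bar>b\<bar>" "0 \<le> a * a" using nonneg by auto
  ultimately have "a\<^sup>2 + 2 * a * \<bar>b\<bar> + 2 * a * Y \<le> 6 * (a * M)"
    by (simp only: power2_eq_square algebra_simps)
  from mult_left_mono[OF this eta(1)] show ?thesis by (simp add: mult_ac)
qed

lemma eta_Y_sq_le: "\<eta> * Y\<^sup>2 \<le> 3 * \<eta> * a * M"
  using mult_left_mono[OF Y_sq_le eta(1)] by (simp add: algebra_simps)

text \<open>The null condition solved for the angular speed, which can then be eliminated
  everywhere.\<close>

lemma Y_sq_approx: "\<bar>Y\<^sup>2 - (a\<^sup>2 + 2 * a * b)\<bar> \<le> 9 * \<eta> * a * M"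
proof -
  have "\<bar>(guu + 1) * a\<^sup>2 + 2 * (gur + 1) * a * b + 2 * a * gu\<bar> \<le> 6 * \<eta> * a * M"
    using abs_quadratic_le[of "guu + 1" "gur + 1" gu] quadratic_le g by linarith
  moreover have "(guu + 1) * a\<^sup>2 + 2 * (gur + 1) * a * b + 2 * a * gu = a\<^sup>2 + 2 * a * b - gh"
    using null by (simp add: algebra_simps)
  ultimately show ?thesis using g(4) eta_Y_sq_le by linarith
qed

text \<open>The flat part of \<open>dq\<close> is \<open>- Y\<^sup>2\<close>. The error is 9 from
  \<open>Y_sq_approx\<close> plus half of 6 + 3 from the remaining terms.\<close>

lemma dq_approx: "\<bar>dq + (a\<^sup>2 + 2 * a * b)\<bar> \<le> 14 * \<eta> * a * M"
proof -
  have "\<bar>kuu * a\<^sup>2 + 2 * kur * a * b + 2 * a * ku\<bar> \<le> 6 * \<eta> * a * M"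
    using abs_quadratic_le[of kuu kur ku] quadratic_le k by simp
  moreover have "0 \<le> \<eta> * a * M" using eta nonneg by simp
  ultimately show ?thesis using k(4) eta_Y_sq_le dq_eq Y_sq_approx by linarith
qed

text \<open>Approximate conservation of energy: the flat metric does not depend on u, so only error
  terms are left.\<close>

lemma de_approx: "\<bar>de\<bar> \<le> 5 * \<eta> * a * M"
proof -
  have "\<bar>luu * a\<^sup>2 + 2 * lur * a * b + 2 * a * lu\<bar> \<le> 6 * \<eta> * a * M"
    using abs_quadratic_le[of luu lur lu] quadratic_le l by simp
  moreover have "0 \<le> \<eta> * a * M" using eta nonneg by simp
  ultimately show ?thesis using l(4) eta_Y_sq_le de_eq by linarith
qed

lemma q_approx: "\<bar>q - a\<bar> \<le> \<eta> * a"
proof -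
  have "q - a = - ((gur + 1) * a)" using q_eq by (simp add: algebra_simps)
  then show ?thesis using mult_right_mono[OF g(2) nonneg(1)] nonneg by (simp add: abs_mult)
qed

lemma e_approx: "\<bar>e - a - b\<bar> \<le> 3 * (\<eta> * M)"
proof -
  have "e - a - b = - ((guu + 1) * a + (gur + 1) * b + gu)" using e_eq by (simp add: algebra_simps)
  moreover have "\<bar>(guu + 1) * a\<bar> \<le> \<eta> * a" "\<bar>(gur + 1) * b\<bar> \<le> \<eta> * \<bar>b\<bar>"
    using mult_right_mono[OF g(1) nonneg(1)] mult_right_mono[OF g(2), of "\<bar>b\<bar>"] nonneg by (simp_all add: abs_mult)
  moreover have "\<eta> * Y \<le> \<eta> * (2 * M)" using Y_le eta(1) by (rule mult_left_mono)
  ultimately show ?thesis using g(3) by (simp add: algebra_simps)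
qed

lemma eta_a_le: "\<eta> * a \<le> a / 30000"
  using mult_right_mono[OF eta(2) nonneg(1)] by simp

lemma q_close: "q \<le> a + a / 30000" "a \<le> q + a / 30000"
  using q_approx eta_a_le by linarith+

lemma e_close: "e \<le> a + b + a / 10000 + \<bar>b\<bar> / 10000" "a + b \<le> e + a / 10000 + \<bar>b\<bar> / 10000"
proof -
  have "\<eta> * M \<le> 1/30000 * M" using eta(2) by (rule mult_right_mono) (use nonneg in simp)
  then have "3 * (\<eta> * M) \<le> a / 10000 + \<bar>b\<bar> / 10000" by simp
  with e_approx show "e \<le> a + b + a / 10000 + \<bar>b\<bar> / 10000" "a + b \<le> e + a / 10000 + \<bar>b\<bar> / 10000"
    by linarith+
qed

text \<open>Recovers the velocity from the momenta: for b \<ge> 0 the sum a + b is nearly e, and for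
  b < 0 the difference a - b = 2 a - (a + b) is nearly 2 q - e.\<close>

lemma M_le: "M \<le> 5/2 * q + 6/5 * \<bar>e\<bar>"
proof (cases "b \<ge> 0")
  case True
  then have "M = a + b" "e \<le> \<bar>e\<bar>" by auto
  then show ?thesis using e_close q_close nonneg True by linarith
next
  case False
  then have "M = a - b" "- e \<le> \<bar>e\<bar>" by auto
  then show ?thesis using e_close q_close nonneg False by linarith
qed

text \<open>Proved before the sign conditions on q and e are imposed. The factor \<open>q\<close> on
  the right is what the Gronwall argument in \<open>q_stays_positive\<close> relies on.\<close>

lemma abs_dq_le: "\<bar>dq\<bar> \<le> 10 * q * (q + \<bar>e\<bar>)"
proof -
  have "\<eta> * (a * M) \<le> 1/30000 * (a * M)"
    using eta nonneg by (intro mult_right_mono) auto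
  moreover have "\<bar>a * b\<bar> = a * \<bar>b\<bar>" "0 \<le> a * \<bar>b\<bar>" "0 \<le> a * a" using nonneg by (auto simp: abs_mult)
  ultimately have "\<bar>dq\<bar> \<le> 3 * (a * M)"
    using dq_approx by (simp only: power2_eq_square algebra_simps)
  also have "a * M \<le> (11/10 * q) * (5/2 * q + 6/5 * \<bar>e\<bar>)"
    using M_le nonneg q_close by (intro mult_mono) auto
  moreover have "0 \<le> q" using nonneg q_close by linarith
  then have "0 \<le> q * q" "0 \<le> q * \<bar>e\<bar>" by auto
  ultimately show ?thesis by (simp add: algebra_simps)
qed

text \<open>The hypothesis gives a + b \<ge> 0.577 a; passing to e and q costs far less than the
  0.017 given away.\<close>

lemma above_critical:
  assumes "a > 0" "b / a \<ge> - (423/1000)"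
  shows "e > 56/100 * q"
proof -
  have "b \<ge> - (423/1000) * a" using assms by (simp add: field_simps)
  then show ?thesis
    using e_close q_close assms(1) by linarith
qed

context
  assumes q_pos: "q > 0" and e_ge: "e \<ge> q / 2"
begin

lemma M_le_e: "M \<le> 7 * e"
  using M_le e_ge q_pos by linarith

text \<open>The expression \<open>de * q - e * dq\<close> is r q^2 times the derivative of e/q, kept
  free of division. Its main part is e a (a + 2 b), and a + 2 b is nearly 2 e - q.\<close>

lemma quotient_derivative_approx:
  "\<bar>de * q - e * dq - a * (2 * e\<^sup>2 - e * q)\<bar> \<le> 1/100 * a * e\<^sup>2"
proof -
  have e0: "0 \<le> e" "0 \<le> q" using q_pos e_ge by auto
  have aM: "\<eta> * a * M \<le> \<eta> * a * (7 * e)"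
    using M_le_e eta nonneg by (intro mult_left_mono) auto
  have "\<bar>de * q\<bar> \<le> (5 * (\<eta> * a * (7 * e))) * (2 * e)"
    unfolding abs_mult using de_approx aM e_ge e0 eta nonneg by (intro mult_mono) auto
  moreover have "\<bar>e * (dq + (a\<^sup>2 + 2 * a * b))\<bar> \<le> e * (14 * (\<eta> * a * (7 * e)))"
    unfolding abs_mult using dq_approx aM e0 by (intro mult_mono) auto
  moreover have "\<bar>e * a * (a + 2 * b - 2 * e + q)\<bar> \<le> e * a * (7 * (\<eta> * (7 * e)))"
  proof -
    have "\<eta> * M \<le> \<eta> * (7 * e)" "\<eta> * a \<le> \<eta> * M"
      using M_le_e eta by (auto intro: mult_left_mono)
    moreover have "\<bar>a + 2 * b - 2 * e + q\<bar> \<le> 7 * y"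
      if "x \<le> y" "w \<le> x" "\<bar>e - a - b\<bar> \<le> 3 * x" "\<bar>q - a\<bar> \<le> w" for x y w
      using that by linarith
    ultimately have "\<bar>a + 2 * b - 2 * e + q\<bar> \<le> 7 * (\<eta> * (7 * e))"
      using e_approx q_approx by blast
    then show ?thesis unfolding abs_mult using e0 nonneg by (intro mult_mono) auto
  qed
  moreover have "de * q - e * dq - a * (2 * e\<^sup>2 - e * q) =
    de * q - e * (dq + (a\<^sup>2 + 2 * a * b)) + e * a * (a + 2 * b - 2 * e + q)"
    by (simp add: algebra_simps power2_eq_square)
  \<comment> \<open>217 = 5*7*2 + 14*7 + 7*7 from the three bounds. The accuracy 1/30000 is chosen
    so that 217/30000 stays below 1/100.\<close>
  ultimately have "\<bar>de * q - e * dq - a * (2 * e\<^sup>2 - e * q)\<bar> \<le> 217 * (\<eta> * (a * e\<^sup>2))"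
    by (simp add: algebra_simps power2_eq_square)
  also have "\<eta> * (a * e\<^sup>2) \<le> 1/30000 * (a * e\<^sup>2)"
    using eta nonneg by (intro mult_right_mono) auto
  moreover have "0 \<le> a * e\<^sup>2" using nonneg by simp
  ultimately show ?thesis by simp
qed

text \<open>This is dr/du = Q - 1 with denominators cleared; it follows from e being close to a + b
  and q close to a.\<close>

lemma b_approx: "\<bar>b * q - a * (e - q)\<bar> \<le> 1/100 * a * e"
proof -
  have "b * q - a * (e - q) = (a + b) * (q - a) + a * (a + b - e)"
    by (simp add: algebra_simps)
  moreover have "\<bar>(a + b) * (q - a)\<bar> \<le> M * (\<eta> * a)"
    unfolding abs_mult using q_approx nonneg by (intro mult_mono) auto
  moreover have "\<bar>a * (a + b - e)\<bar> \<le> a * (3 * (\<eta> * M))"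
    unfolding abs_mult using e_approx nonneg by (intro mult_mono) auto
  ultimately have "\<bar>b * q - a * (e - q)\<bar> \<le> 4 * (\<eta> * (a * M))"
    by (simp add: algebra_simps)
  also have "\<eta> * (a * M) \<le> 1/30000 * (a * (7 * e))"
    using eta nonneg M_le_e by (intro mult_mono) auto
  moreover have "0 \<le> a * e" using nonneg q_pos e_ge by simp
  ultimately show ?thesis by simp
qed

text \<open>Bounds the speed per unit of u by a multiple of Q, so that bounded Q and bounded u give
  finite length. The constant covers 3 * 7 * 101/100.\<close>

lemma speed_le: "a + \<bar>b\<bar> + Y \<le> 25 * a * (e / q)"
proof -
  have "e * q \<le> e * (101/100 * a)"
    using q_close e_ge q_pos nonneg by (intro mult_left_mono) auto
  then have "e \<le> 101/100 * a * (e / q)" using q_pos by (simp add: field_simps)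
  moreover have "0 \<le> a * (e / q)" using nonneg q_pos e_ge by simp
  ultimately show ?thesis using Y_le M_le_e by (simp add: algebra_simps)
qed

end

end

section \<open>The dynamics of photons far out\<close>

lemma params_downward: "t \<in> params b \<Longrightarrow> 0 \<le> x \<Longrightarrow> x \<le> t \<Longrightarrow> x \<in> params b"
  unfolding params_def by (auto intro: le_less_trans[of "ereal x" "ereal t" b])

lemma between_params: "s \<in> params b \<Longrightarrow> t \<in> params b \<Longrightarrow> s \<le> x \<Longrightarrow> x \<le> t \<Longrightarrow> x \<in> params b"
  using params_downward[of t b x] by (auto simp: params_def)

lemma atLeastAtMost_subset_params: "t \<in> params b \<Longrightarrow> {0..t} \<subseteq> params b"
  using params_downward by auto

lemma at_within_params: "0 < x \<Longrightarrow> x < t \<Longrightarrow> t \<in> params b \<Longrightarrow> at x within params b = at x"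
  by (rule at_within_open_subset[of x "{0<..<t}"]) (use params_downward[of t b] in auto)

lemma zero_in_params: "0 < b \<Longrightarrow> 0 \<in> params b"
  by (simp add: params_def zero_ereal_def)

lemma nondecreasing_params:
  fixes f :: "real \<Rightarrow> real"
  assumes "s \<in> params b" "t \<in> params b" "s \<le> t"
    and "\<And>x. s \<le> x \<Longrightarrow> x \<le> t \<Longrightarrow> (f has_real_derivative d x) (at x within params b)"
    and "\<And>x. s \<le> x \<Longrightarrow> x \<le> t \<Longrightarrow> d x \<ge> 0"
  shows "f s \<le> f t"
proof -
  have sub: "{s..t} \<subseteq> params b"
    using between_params[OF assms(1,2)] by auto
  have "\<exists>x\<in>{s..t}. f t - f s = (*) (d x) (t - s)"
    using assms(3) by (rule mvt_very_simple)
      (use assms(4) sub has_derivative_subset in \<open>unfold has_field_derivative_def, blast\<close>)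
  then show ?thesis using assms(3,5) by (metis atLeastAtMost_iff diff_ge_0_iff_ge mult_nonneg_nonneg)
qed

text \<open>A first parameter with f \<le> 0 would exist because that set is closed, and the
  induction hypothesis excludes it. At t = 0 the inner premise is vacuous, so the base case is
  included.\<close>

lemma continuity_induction_params:
  fixes f :: "real \<Rightarrow> real"
  assumes "continuous_on (params b) f"
    and "\<And>t. t \<in> params b \<Longrightarrow> (\<And>s. 0 \<le> s \<Longrightarrow> s < t \<Longrightarrow> f s > 0) \<Longrightarrow> f t > 0"
    and "t \<in> params b"
  shows "f t > 0"
proof (rule ccontr)
  assume neg: "\<not> f t > 0"
  define Z where "Z = {s \<in> {0..t}. f s \<le> 0}"
  have "continuous_on {0..t} f"
    using assms(1) atLeastAtMost_subset_params[OF assms(3)] continuous_on_subset by blast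
  then have "closed Z"
    unfolding Z_def by (intro continuous_on_closed_Collect_le) auto
  moreover have "Z \<noteq> {}" "bdd_below Z"
    using neg assms(3) by (auto simp: Z_def params_def intro!: bdd_belowI[of _ 0])
  ultimately have "Inf Z \<in> Z" by (rule closed_contains_Inf[rotated 2])
  then have "Inf Z \<in> params b" "f (Inf Z) \<le> 0" "Inf Z \<le> t"
    using atLeastAtMost_subset_params[OF assms(3)] by (auto simp: Z_def)
  moreover have "f s > 0" if "0 \<le> s" "s < Inf Z" for s
  proof (rule ccontr)
    assume "\<not> f s > 0"
    then have "s \<in> Z" using that \<open>Inf Z \<le> t\<close> by (auto simp: Z_def)
    then show False using cInf_lower[OF _ \<open>bdd_below Z\<close>] that by fastforce
  qed
  ultimately show False using assms(2)[of "Inf Z"] by fastforce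
qed

lemma eventually_param_end:
  assumes "s0 \<in> params b" "\<And>s. s \<in> params b \<Longrightarrow> s0 \<le> s \<Longrightarrow> P s"
  shows "eventually P (param_end b)"
proof -
  have "ereal s0 < b" "0 \<le> s0" using assms(1) by (auto simp: params_def)
  then have "eventually (\<lambda>x. x \<in> {ereal s0<..<b}) (at_left b)"
    by (intro eventually_at_leftI[of "ereal s0"]) auto
  then show ?thesis
    unfolding param_end_def eventually_filtercomap
    by (intro exI conjI) (use assms(2) \<open>0 \<le> s0\<close> in \<open>auto simp: params_def\<close>)
qed

text \<open>Here \<open>\<phi>\<close> plays the role of arc length: it is nondecreasing because
  distances are nonnegative, and finite length in a complete space forces a limit.\<close>

lemma convergent_of_bounded_control:
  fixes \<gamma> :: "real \<Rightarrow> 'a::banach" and \<phi> :: "real \<Rightarrow> real"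
  assumes "0 < b"
    and "\<And>s t. s \<in> params b \<Longrightarrow> t \<in> params b \<Longrightarrow> s \<le> t \<Longrightarrow> dist (\<gamma> s) (\<gamma> t) \<le> \<phi> t - \<phi> s"
    and "bdd_above (\<phi> ` params b)"
  obtains p where "(\<gamma> \<longlongrightarrow> p) (param_end b)"
proof -
  let ?L = "Sup (\<phi> ` params b)"
  have L: "\<phi> t \<le> ?L" if "t \<in> params b" for t
    using cSup_upper[OF _ assms(3)] that by blast
  have "\<exists>s\<in>params b. \<phi> s > ?L - 1 / real (Suc k)" for k
    using less_cSup_iff[OF _ assms(3), of "?L - 1 / real (Suc k)"] zero_in_params[OF assms(1)] by auto
  then obtain \<sigma> where \<sigma>: "\<sigma> k \<in> params b" "\<phi> (\<sigma> k) > ?L - 1 / real (Suc k)" for k by metis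
  \<comment> \<open>Past \<open>\<sigma> k\<close> less than 1/(k+1) of the control is left. The
    parameters \<open>\<sigma> k\<close> are not ordered, so the Cauchy property has to compare two
    of them in either order.\<close>
  have close: "dist (\<gamma> (\<sigma> k)) (\<gamma> t) \<le> 1 / real (Suc k)" if "t \<in> params b" "\<sigma> k \<le> t" for t k
    using assms(2)[OF \<sigma>(1) that] L[OF that(1)] \<sigma>(2)[of k] by linarith
  have "Cauchy (\<lambda>k. \<gamma> (\<sigma> k))"
  proof (rule metric_CauchyI)
    fix \<epsilon> :: real assume "\<epsilon> > 0"
    then obtain N where N: "1 / real (Suc N) < \<epsilon>" using nat_approx_posE by blast
    have *: "dist (\<gamma> (\<sigma> i)) (\<gamma> (\<sigma> j)) < \<epsilon>" if "N \<le> i" "N \<le> j" "\<sigma> i \<le> \<sigma> j" for i j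
    proof -
      have "1 / real (Suc i) \<le> 1 / real (Suc N)" using that by (simp add: frac_le)
      then show ?thesis using close[OF \<sigma>(1) that(3)] N by linarith
    qed
    show "\<exists>M. \<forall>m\<ge>M. \<forall>n\<ge>M. dist (\<gamma> (\<sigma> m)) (\<gamma> (\<sigma> n)) < \<epsilon>"
      by (metis * dist_commute linorder_linear)
  qed
  then obtain p where p: "(\<lambda>k. \<gamma> (\<sigma> k)) \<longlonglongrightarrow> p"
    using Cauchy_convergent_iff convergentD by blast
  have "(\<gamma> \<longlongrightarrow> p) (param_end b)"
  proof (rule tendstoI)
    fix \<epsilon> :: real assume "\<epsilon> > 0"
    then obtain N where N: "1 / real (Suc N) < \<epsilon> / 2" using nat_approx_posE[of "\<epsilon>/2"] by auto
    have "eventually (\<lambda>k. dist (\<gamma> (\<sigma> k)) p < \<epsilon> / 2 \<and> k \<ge> N) sequentially"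
      using p \<open>\<epsilon> > 0\<close> by (intro eventually_conj tendstoD eventually_ge_at_top) auto
    then obtain k where k: "dist (\<gamma> (\<sigma> k)) p < \<epsilon> / 2" "k \<ge> N"
      by (auto simp: eventually_sequentially)
    have "1 / real (Suc k) \<le> 1 / real (Suc N)" using k(2) by (simp add: frac_le)
    then have "dist (\<gamma> t) p < \<epsilon>" if "t \<in> params b" "\<sigma> k \<le> t" for t
      using close[OF that] k(1) N dist_triangle3[of "\<gamma> t" p "\<gamma> (\<sigma> k)"] by linarith
    then show "eventually (\<lambda>t. dist (\<gamma> t) p < \<epsilon>) (param_end b)"
      by (intro eventually_param_end[OF \<sigma>(1)])
  qed
  then show thesis by (rule that)
qed

text \<open>The whole geometry enters the dynamics through these inequalities. The estimates for the
  quotient, for r and for the speed carry the factor \<open>du\<close> and hence integrate against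
  u, whatever the affine parametrization. Only \<open>dq_le\<close> holds without sign conditions,
  since it serves to establish them.\<close>

locale photon_estimates =
  fixes b :: ereal and \<gamma> v :: "real \<Rightarrow> 'a::banach"
    and u r q e du dr dq de :: "real \<Rightarrow> real" and R1 :: real
  assumes b_pos: "0 < b"
    and deriv_u: "\<And>s. s \<in> params b \<Longrightarrow> (u has_real_derivative du s) (at s within params b)"
    and deriv_r: "\<And>s. s \<in> params b \<Longrightarrow> (r has_real_derivative dr s) (at s within params b)"
    and deriv_q: "\<And>s. s \<in> params b \<Longrightarrow> (q has_real_derivative dq s) (at s within params b)"
    and deriv_e: "\<And>s. s \<in> params b \<Longrightarrow> (e has_real_derivative de s) (at s within params b)"
    and deriv_\<gamma>: "\<And>s. s \<in> params b \<Longrightarrow> (\<gamma> has_vector_derivative v s) (at s within params b)"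
    and du_nonneg: "\<And>s. s \<in> params b \<Longrightarrow> 0 \<le> du s"
    and R1: "R1 \<ge> 1"
    and dq_le: "\<And>s. s \<in> params b \<Longrightarrow> r s \<ge> R1 \<Longrightarrow> \<bar>r s * dq s\<bar> \<le> 10 * q s * (q s + \<bar>e s\<bar>)"
    and quotient_approx: "\<And>s. s \<in> params b \<Longrightarrow> r s \<ge> R1 \<Longrightarrow> q s > 0 \<Longrightarrow> e s \<ge> q s / 2 \<Longrightarrow>
      \<bar>r s * de s * q s - e s * (r s * dq s) - du s * (2 * (e s)\<^sup>2 - e s * q s)\<bar> \<le> 1/100 * du s * (e s)\<^sup>2"
    and dr_approx: "\<And>s. s \<in> params b \<Longrightarrow> r s \<ge> R1 \<Longrightarrow> q s > 0 \<Longrightarrow> e s \<ge> q s / 2 \<Longrightarrow>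
      \<bar>dr s * q s - du s * (e s - q s)\<bar> \<le> 1/100 * du s * e s"
    and norm_v_le: "\<And>s. s \<in> params b \<Longrightarrow> r s \<ge> R1 \<Longrightarrow> q s > 0 \<Longrightarrow> e s \<ge> q s / 2 \<Longrightarrow>
      norm (v s) \<le> 25 * du s * (e s / q s)"
    and init: "q 0 > 0" "e 0 > 56/100 * q 0" "r 0 > R1 * exp 6"
begin

definition Q :: "real \<Rightarrow> real" where "Q s = e s / q s"
definition dQ :: "real \<Rightarrow> real" where "dQ s = (de s * q s - e s * dq s) / (q s)\<^sup>2"

text \<open>The threshold 56/100 lies above 1/2 by enough for both \<open>dQ_nonneg\<close> and
  \<open>log_barrier_nonneg\<close> to survive the errors of one percent.\<close>

definition good :: "real \<Rightarrow> bool" where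
  "good s \<longleftrightarrow> s \<in> params b \<and> r s \<ge> R1 \<and> q s > 0 \<and> e s \<ge> 56/100 * q s"

lemma
  assumes "good s"
  shows good_params: "s \<in> params b" and good_r: "r s \<ge> R1" "r s > 0" "r s \<ge> 1"
    and good_q: "q s > 0" and good_Q: "Q s \<ge> 56/100" "Q s > 0" and good_e: "e s \<ge> q s / 2" "e s = Q s * q s"
  using assms R1 by (auto simp: good_def Q_def field_simps intro: order_trans)

lemma deriv_Q:
  assumes "good s"
  shows "(Q has_real_derivative dQ s) (at s within params b)"
proof -
  have "((\<lambda>s. e s / q s) has_real_derivative (de s * q s - e s * dq s) / (q s * q s)) (at s within params b)"
    using good_q[OF assms] good_params[OF assms] by (intro DERIV_divide deriv_e deriv_q) auto
  then show ?thesis by (simp add: Q_def[abs_def] dQ_def power2_eq_square)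
qed

lemma dQ_bounds:
  assumes "good s"
  shows "r s * dQ s \<ge> du s * (199/100 * (Q s)\<^sup>2 - Q s)" (is ?lo)
    and "r s * dQ s \<le> du s * (201/100 * (Q s)\<^sup>2 - Q s)" (is ?hi)
proof -
  note g = good_params[OF assms] good_r[OF assms] good_q[OF assms] good_Q[OF assms] good_e[OF assms]
  have rdQ: "r s * dQ s * (q s)\<^sup>2 = r s * de s * q s - e s * (r s * dq s)"
    using g by (simp add: dQ_def field_simps)
  have "\<bar>r s * dQ s * (q s)\<^sup>2 - du s * (2 * (Q s)\<^sup>2 - Q s) * (q s)\<^sup>2\<bar> \<le> 1/100 * du s * (Q s)\<^sup>2 * (q s)\<^sup>2"
    using quotient_approx[OF g(1,2,5,8)] unfolding rdQ unfolding g(9)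
    by (simp add: power2_eq_square algebra_simps)
  then have "\<bar>(r s * dQ s - du s * (2 * (Q s)\<^sup>2 - Q s)) * (q s)\<^sup>2\<bar> \<le> (1/100 * du s * (Q s)\<^sup>2) * (q s)\<^sup>2"
    by (simp add: algebra_simps)
  then have "\<bar>r s * dQ s - du s * (2 * (Q s)\<^sup>2 - Q s)\<bar> \<le> 1/100 * du s * (Q s)\<^sup>2"
    using g(5) by (simp add: abs_mult)
  from abs_le_D1[OF this] abs_le_D2[OF this] show ?lo ?hi
    by (simp_all add: algebra_simps)
qed

lemma dr_bounds:
  assumes "good s"
  shows "dr s \<ge> du s * (99/100 * Q s - 1)" (is ?lo)
    and "dr s \<le> du s * (101/100 * Q s - 1)" (is ?hi)
proof -
  note g = good_params[OF assms] good_r[OF assms] good_q[OF assms] good_Q[OF assms] good_e[OF assms]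
  have "\<bar>(dr s - du s * (Q s - 1)) * q s\<bar> \<le> (1/100 * du s * Q s) * q s"
    using dr_approx[OF g(1,2,5,8)] unfolding g(9)
    by (simp add: algebra_simps)
  then have "\<bar>dr s - du s * (Q s - 1)\<bar> \<le> 1/100 * du s * Q s"
    using g(5) by (simp add: abs_mult)
  from abs_le_D1[OF this] abs_le_D2[OF this] show ?lo ?hi
    by (simp_all add: algebra_simps)
qed

lemma dQ_nonneg:
  assumes "good s"
  shows "dQ s \<ge> 0"
proof -
  note g = good_params[OF assms] good_r[OF assms] good_Q[OF assms]
  \<comment> \<open>Uses 199/100 * 56/100 > 1.\<close>
  have "0 \<le> du s * (Q s * (199/100 * Q s - 1))"
    using g du_nonneg[OF g(1)] by (intro mult_nonneg_nonneg) auto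
  also have "\<dots> \<le> r s * dQ s"
    using dQ_bounds(1)[OF assms] by (simp add: algebra_simps power2_eq_square)
  finally show ?thesis using g(3) by (simp add: zero_le_mult_iff)
qed

text \<open>In Minkowski space \<open>Q = 1 + dr/du\<close> and \<open>r dQ/du = Q (2 Q - 1)\<close>, so that
  \<open>r d/du (ln r - 3 / Q) = 5 + Q - 3 / Q\<close>, which is positive for \<open>Q \<ge> 56/100\<close>.\<close>

lemma log_barrier_nonneg:
  assumes "good s"
  shows "dr s / r s + 3 * dQ s / (Q s)\<^sup>2 \<ge> 0"
proof -
  note g = good_params[OF assms] good_r[OF assms] good_Q[OF assms]
  \<comment> \<open>The expression increases with \<open>Q s\<close>, and at 56/100 it is still
    about 0.167.\<close>
  have Q: "0 \<le> 99/100 * Q s - 1 + 3 * (199/100 - 1 / Q s)"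
  proof -
    have "1 / Q s \<le> 1 / (56/100)" using g by (intro divide_left_mono) auto
    then show ?thesis using g by simp
  qed
  have "0 \<le> du s * (99/100 * Q s - 1 + 3 * (199/100 - 1 / Q s))"
    using Q du_nonneg[OF g(1)] by simp
  also have "\<dots> = du s * (99/100 * Q s - 1) + 3 * (du s * (199/100 * (Q s)\<^sup>2 - Q s)) / (Q s)\<^sup>2"
    using g by (simp add: field_simps power2_eq_square)
  also have "\<dots> \<le> dr s + 3 * (r s * dQ s) / (Q s)\<^sup>2"
    using dr_bounds(1)[OF assms] dQ_bounds(1)[OF assms]
    by (intro add_mono divide_right_mono mult_left_mono) auto
  also have "\<dots> = r s * (dr s / r s + 3 * dQ s / (Q s)\<^sup>2)"
    using g by (simp add: field_simps)
  finally show ?thesis using g(3) by (simp add: zero_le_mult_iff)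
qed

section \<open>Bootstrap: the good regime persists\<close>

lemma continuous_params:
  "continuous_on (params b) u" "continuous_on (params b) r"
  "continuous_on (params b) q" "continuous_on (params b) e"
  using deriv_u deriv_r deriv_q deriv_e by (meson DERIV_continuous_on)+

text \<open>Gronwall's argument: if K bounds q + |e| on the compact interval [0, t], then |q'| \<le>
  10 K q because r \<ge> 1, and \<open>q s * exp (10 * K * s)\<close> is nondecreasing. The quotient
  Q is avoided, as q is only known to be nonnegative here.\<close>

lemma q_stays_positive:
  assumes "t \<in> params b" "\<And>s. 0 \<le> s \<Longrightarrow> s \<le> t \<Longrightarrow> r s \<ge> R1 \<and> q s \<ge> 0"
  shows "q t > 0"
proof -
  note sub = atLeastAtMost_subset_params[OF assms(1)]
  have "compact ((\<lambda>s. q s + \<bar>e s\<bar>) ` {0..t})"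
    using continuous_params sub
    by (intro compact_continuous_image continuous_intros) (auto intro: continuous_on_subset)
  then have "bdd_above ((\<lambda>s. q s + \<bar>e s\<bar>) ` {0..t})"
    by (intro bounded_imp_bdd_above compact_imp_bounded)
  then obtain K where "\<forall>y\<in>(\<lambda>s. q s + \<bar>e s\<bar>) ` {0..t}. y \<le> K"
    unfolding bdd_above_def by blast
  then have K: "q s + \<bar>e s\<bar> \<le> K" if "0 \<le> s" "s \<le> t" for s
    using that by simp
  have "q 0 * exp (10 * K * 0) \<le> q t * exp (10 * K * t)"
  proof (rule nondecreasing_params[where f = "\<lambda>s. q s * exp (10 * K * s)" and d = "\<lambda>s. (dq s + 10 * K * q s) * exp (10 * K * s)"])
    fix s assume s: "0 \<le> s" "s \<le> t"
    then have sp: "s \<in> params b" using sub by auto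
    show "((\<lambda>s. q s * exp (10 * K * s)) has_real_derivative (dq s + 10 * K * q s) * exp (10 * K * s)) (at s within params b)"
      by (rule derivative_eq_intros deriv_q sp refl)+ (simp add: algebra_simps)
    have "\<bar>dq s\<bar> \<le> r s * \<bar>dq s\<bar>"
      using assms(2)[OF s] R1 by (simp add: mult_le_cancel_right1)
    also have "\<dots> = \<bar>r s * dq s\<bar>"
      using assms(2)[OF s] R1 by (simp add: abs_mult)
    also have "\<dots> \<le> 10 * q s * (q s + \<bar>e s\<bar>)"
      using dq_le[OF sp] assms(2)[OF s] by simp
    also have "\<dots> \<le> 10 * q s * K"
      using K[OF s] assms(2)[OF s] by (intro mult_left_mono) auto
    finally show "(dq s + 10 * K * q s) * exp (10 * K * s) \<ge> 0"
      by (intro mult_nonneg_nonneg) (auto simp: algebra_simps)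
  qed (use assms zero_in_params b_pos in \<open>auto simp: params_def\<close>)
  then have "0 < q t * exp (10 * K * t)" using init(1) by simp
  then show ?thesis by (simp add: zero_less_mult_iff)
qed

text \<open>The non-strict conditions improve themselves to strict ones: q by Gronwall, e/q by
  monotonicity of \<open>Q\<close> from its strict initial bound, and r by the logarithmic
  barrier.\<close>

lemma stays_good_step:
  assumes t: "t \<in> params b" and ge: "\<And>s. 0 \<le> s \<Longrightarrow> s \<le> t \<Longrightarrow> r s \<ge> R1 \<and> q s \<ge> 0 \<and> e s \<ge> 56/100 * q s"
  shows "r t > R1" "q t > 0" "e t > 56/100 * q t"
proof -
  have good: "good s" if s: "0 \<le> s" "s \<le> t" for s
  proof -
    have sp: "s \<in> params b" using params_downward[OF t s] .
    have "q s > 0" by (rule q_stays_positive[OF sp]) (use ge s in auto)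
    then show ?thesis unfolding good_def using sp ge[OF s] by simp
  qed
  have t0: "0 \<le> t" "0 \<in> params b" using t zero_in_params[OF b_pos] by (auto simp: params_def)
  have gt: "good t" and g0: "good 0" using good t0(1) by auto
  have "Q 0 \<le> Q t"
  proof (rule nondecreasing_params[OF t0(2) t t0(1), where f = Q and d = dQ])
    fix s assume "0 \<le> s" "s \<le> t"
    then have "good s" by (rule good)
    then show "(Q has_real_derivative dQ s) (at s within params b)" "0 \<le> dQ s"
      by (rule deriv_Q, rule dQ_nonneg)
  qed
  moreover have "Q 0 > 56/100" using init by (simp add: Q_def field_simps)
  ultimately have "Q t > 56/100" by linarith
  then show "q t > 0" "e t > 56/100 * q t"
    using good_q[OF gt] by (auto simp: Q_def field_simps)
  have "ln (r 0) - 3 / Q 0 \<le> ln (r t) - 3 / Q t"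
  proof (rule nondecreasing_params[OF t0(2) t t0(1), where f = "\<lambda>s. ln (r s) - 3 / Q s" and d = "\<lambda>s. dr s / r s + 3 * dQ s / (Q s)\<^sup>2"])
    fix s assume "0 \<le> s" "s \<le> t"
    then have g: "good s" by (rule good)
    note gs = good_params[OF g] good_r[OF g] good_Q[OF g]
    show "((\<lambda>s. ln (r s) - 3 / Q s) has_real_derivative dr s / r s + 3 * dQ s / (Q s)\<^sup>2) (at s within params b)"
    proof -
      have "((\<lambda>s. ln (r s)) has_real_derivative dr s / r s) (at s within params b)"
        by (rule derivative_eq_intros deriv_r gs refl)+ simp
      from DERIV_diff[OF this DERIV_divide[OF DERIV_const[of 3] deriv_Q[OF g]]] gs
      show ?thesis by (simp add: power2_eq_square)
    qed
    show "0 \<le> dr s / r s + 3 * dQ s / (Q s)\<^sup>2" by (rule log_barrier_nonneg[OF g])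
  qed
  \<comment> \<open>3 divided by 56/100 is below 5.4. Hence ln r can fall by less than 6, which is
    the origin of \<open>exp 6\<close> in the initial condition.\<close>
  moreover have "3 / Q 0 < 6"
    using good_Q[OF g0] by (simp add: field_simps)
  moreover have "3 / Q t > 0" using good_Q[OF gt] by simp
  ultimately have "ln (r t) > ln (r 0) - 6" by linarith
  moreover have "ln (r 0) > ln (R1 * exp 6)"
    using init(3) R1 by (subst ln_less_cancel_iff) (auto intro: less_trans[rotated])
  then have "ln (r 0) > ln R1 + 6" using R1 by (simp add: ln_mult)
  ultimately have "ln (r t) > ln R1" by linarith
  then show "r t > R1" using R1 good_r[OF gt] by simp
qed

lemma always_good:
  assumes "t \<in> params b"
  shows "good t"
proof -
  \<comment> \<open>The smallest of the three margins, so that one continuous function carries the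
    induction.\<close>
  define f where "f s = min (r s - R1) (min (q s) (e s - 56/100 * q s))" for s
  have cont: "continuous_on (params b) f"
    unfolding f_def using continuous_params by (intro continuous_intros)
  have "f t > 0"
  proof (rule continuity_induction_params[OF cont _ assms])
    fix t assume t: "t \<in> params b" and pos: "\<And>s. 0 \<le> s \<Longrightarrow> s < t \<Longrightarrow> f s > 0"
    show "f t > 0"
    proof (cases "t = 0")
      case True
      have "R1 * 1 \<le> R1 * exp 6" using R1 by (intro mult_left_mono) auto
      then show ?thesis using init True by (auto simp: f_def)
    next
      case False
      then have t0: "t > 0" using t by (auto simp: params_def)
      have cont_t: "continuous_on {0..t} f"
        using cont atLeastAtMost_subset_params[OF t] continuous_on_subset by blast
      have f0: "f s \<ge> 0" if "0 \<le> s" "s \<le> t" for s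
      proof (rule continuous_ge_on_closure[of "{0..<t}" f s 0])
        show "f x \<ge> 0" if "x \<in> {0..<t}" for x using pos[of x] that by simp
      qed (use cont_t t0 that in \<open>simp_all add: closure_atLeastLessThan\<close>)
      have "r s \<ge> R1 \<and> q s \<ge> 0 \<and> e s \<ge> 56/100 * q s" if "0 \<le> s" "s \<le> t" for s
        using f0[OF that] by (simp add: f_def)
      from stays_good_step[OF t this] show ?thesis by (simp add: f_def)
    qed
  qed
  then show ?thesis using assms by (simp add: f_def good_def)
qed

section \<open>Long-time behaviour of u, Q and r\<close>

lemma u_mono:
  assumes "s \<in> params b" "t \<in> params b" "s \<le> t"
  shows "u s \<le> u t"
proof (rule nondecreasing_params[OF assms, where f = u and d = du])
  fix x assume "s \<le> x" "x \<le> t"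
  then have "x \<in> params b" by (rule between_params[OF assms(1,2)])
  then show "(u has_real_derivative du x) (at x within params b)" "0 \<le> du x"
    by (rule deriv_u, rule du_nonneg)
qed

lemma Q_mono:
  assumes "s \<in> params b" "t \<in> params b" "s \<le> t"
  shows "Q s \<le> Q t"
proof (rule nondecreasing_params[OF assms, where f = Q and d = dQ])
  fix x assume "s \<le> x" "x \<le> t"
  then have "good x" by (rule always_good[OF between_params[OF assms(1,2)]])
  then show "(Q has_real_derivative dQ x) (at x within params b)" "0 \<le> dQ x"
    by (rule deriv_Q, rule dQ_nonneg)
qed

text \<open>In Minkowski space \<open>u + r / Q\<close> is constant.\<close>

lemma u_bounded:
  assumes t: "t \<in> params b"
  shows "u t \<le> u 0 + 2 * (r 0 / Q 0)"
proof -
  have t0: "0 \<le> t" "0 \<in> params b" using t zero_in_params[OF b_pos] by (auto simp: params_def)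
  have "- (r 0 / Q 0) - u 0 / 2 \<le> - (r t / Q t) - u t / 2"
  proof (rule nondecreasing_params[OF t0(2) t t0(1), where f = "\<lambda>s. - (r s / Q s) - u s / 2" and d = "\<lambda>s. - ((dr s * Q s - r s * dQ s) / (Q s)\<^sup>2) - du s / 2"])
    fix s assume "0 \<le> s" "s \<le> t"
    then have g: "good s" using always_good between_params t0 t by blast
    note gs = good_params[OF g] good_r[OF g] good_Q[OF g]
    show "((\<lambda>s. - (r s / Q s) - u s / 2) has_real_derivative - ((dr s * Q s - r s * dQ s) / (Q s)\<^sup>2) - du s / 2) (at s within params b)"
      using DERIV_diff[OF DERIV_minus[OF DERIV_divide[OF deriv_r[OF gs(1)] deriv_Q[OF g]]]
          DERIV_cdivide[OF deriv_u[OF gs(1)], of 2]] gs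
      by (simp add: power2_eq_square)
    have "dr s * Q s \<le> du s * (101/100 * Q s - 1) * Q s"
      using dr_bounds(2)[OF g] gs by (intro mult_right_mono) auto
    \<comment> \<open>The terms linear in Q cancel, leaving 101/100 - 199/100. The flat coefficient
      is -1; asking only for -1/2, that is for u/2, leaves room for the error.\<close>
    then have "dr s * Q s - r s * dQ s \<le> - (98/100) * (du s * (Q s)\<^sup>2)"
      using dQ_bounds(1)[OF g] by (simp add: algebra_simps power2_eq_square)
    also have "\<dots> \<le> - (1/2) * (du s * (Q s)\<^sup>2)"
      using du_nonneg[OF gs(1)] by (intro mult_right_mono) auto
    finally have "(dr s * Q s - r s * dQ s) / (Q s)\<^sup>2 \<le> - du s / 2"
      using gs by (simp add: field_simps)
    then show "0 \<le> - ((dr s * Q s - r s * dQ s) / (Q s)\<^sup>2) - du s / 2" by linarith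
  qed
  moreover have "r t / Q t \<ge> 0" using good_r[OF always_good[OF t]] good_Q[OF always_good[OF t]] by simp
  ultimately show ?thesis by simp
qed

text \<open>The speed is at most 25 K u', so 25 K u controls the length of the curve, and u is
  bounded above by \<open>u_bounded\<close>.\<close>

lemma converges_if_Q_bounded:
  assumes K: "\<And>s. s \<in> params b \<Longrightarrow> Q s \<le> K"
  obtains p where "(\<gamma> \<longlongrightarrow> p) (param_end b)"
proof (rule convergent_of_bounded_control[OF b_pos])
  show "dist (\<gamma> s) (\<gamma> t) \<le> 25 * K * u t - 25 * K * u s" if st: "s \<in> params b" "t \<in> params b" "s \<le> t" for s t
  proof (cases "s = t")
    case False
    have "norm (\<gamma> t - \<gamma> s) \<le> 25 * K * u t - 25 * K * u s"
    proof (rule differentiable_bound_general[where f' = "v" and \<phi>' = "\<lambda>s. 25 * K * du s"])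
      have sub: "{s..t} \<subseteq> params b" using between_params[OF st(1,2)] by auto
      show "continuous_on {s..t} \<gamma>"
        by (rule continuous_on_vector_derivative[of _ _ v])
          (use deriv_\<gamma> sub has_vector_derivative_within_subset in blast)
      show "continuous_on {s..t} (\<lambda>s. 25 * K * u s)"
        using continuous_on_subset[OF continuous_params(1) sub] by (intro continuous_intros)
      fix x assume x: "s < x" "x < t"
      then have xp: "x \<in> params b" and within: "at x within params b = at x"
        using between_params[OF st(1,2), of x] st(2) at_within_params[of x t b] x st(1) by (auto simp: params_def)
      show "(\<gamma> has_vector_derivative v x) (at x)" using deriv_\<gamma>[OF xp] within by simp
      have "(u has_vector_derivative du x) (at x)"
        using deriv_u[OF xp] within by (simp add: has_real_derivative_iff_has_vector_derivative)
      then show "((\<lambda>s. 25 * K * u s) has_vector_derivative 25 * K * du x) (at x)"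
        by (rule has_vector_derivative_mult_right)
      have g: "good x" using always_good[OF xp] .
      have "norm (v x) \<le> 25 * du x * Q x"
        using norm_v_le[OF xp good_r(1)[OF g] good_q[OF g] good_e(1)[OF g]] by (simp add: Q_def)
      also have "\<dots> \<le> 25 * du x * K" using K[OF xp] du_nonneg[OF xp] by (intro mult_left_mono) auto
      finally show "norm (v x) \<le> 25 * K * du x" by (simp add: mult_ac)
    qed (use st False in auto)
    then show ?thesis by (simp add: norm_minus_commute dist_norm)
  qed simp
  have "K \<ge> 0" using K[OF zero_in_params[OF b_pos]] good_Q(2)[OF always_good[OF zero_in_params[OF b_pos]]] by simp
  then show "bdd_above ((\<lambda>s. 25 * K * u s) ` params b)"
    using u_bounded by (intro bdd_aboveI2[where M = "25 * K * (u 0 + 2 * (r 0 / Q 0))"] mult_left_mono) auto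
qed (use that in blast)

text \<open>In Minkowski space d(ln Q)/d(ln r) = (2 Q - 1)/(Q - 1), which is at most 3 for Q \<ge>
  2. So Q grows no faster than a power of r, and the fifth power leaves ample room for the
  errors.\<close>

lemma r_tends_to_infinity:
  assumes unbdd: "\<not> bdd_above (Q ` params b)"
  shows "filterlim r at_top (param_end b)"
proof -
  have "\<not> (\<forall>s\<in>params b. Q s \<le> 2)" using unbdd by (auto simp: bdd_above_def)
  then obtain s0 where s0: "s0 \<in> params b" "Q s0 > 2" by force
  have power: "(r s) ^ 5 / Q s \<le> (r t) ^ 5 / Q t"
    if "s \<in> params b" "t \<in> params b" "s \<le> t" "s0 \<le> s" for s t
  proof (rule nondecreasing_params[OF that(1-3), where f = "\<lambda>s. (r s) ^ 5 / Q s"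
        and d = "\<lambda>s. (5 * (r s) ^ 4 * dr s * Q s - (r s) ^ 5 * dQ s) / (Q s)\<^sup>2"])
    fix x assume x: "s \<le> x" "x \<le> t"
    then have g: "good x" using always_good between_params that by blast
    note gs = good_params[OF g] good_r[OF g] good_Q[OF g]
    have "Q x > 2" using Q_mono[OF s0(1) gs(1)] x that(4) s0(2) by simp
    show "((\<lambda>s. (r s) ^ 5 / Q s) has_real_derivative
        (5 * (r x) ^ 4 * dr x * Q x - (r x) ^ 5 * dQ x) / (Q x)\<^sup>2) (at x within params b)"
      using DERIV_divide[OF DERIV_power[OF deriv_r[OF gs(1)], of 5] deriv_Q[OF g]] gs
      by (simp add: power2_eq_square mult_ac)
    have "r x * dQ x \<le> du x * (Q x * (201/100 * Q x - 1))"
      using dQ_bounds(2)[OF g] by (simp add: algebra_simps power2_eq_square)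
    \<comment> \<open>Amounts to 294/100 * Q \<ge> 4, which Q > 2 guarantees.\<close>
    also have "\<dots> \<le> du x * (Q x * (5 * (99/100 * Q x - 1)))"
      using \<open>Q x > 2\<close> du_nonneg[OF gs(1)] by (intro mult_left_mono) auto
    also have "\<dots> = 5 * Q x * (du x * (99/100 * Q x - 1))" by (simp add: algebra_simps)
    also have "\<dots> \<le> 5 * Q x * dr x"
      using dr_bounds(1)[OF g] gs by (intro mult_left_mono) auto
    finally have "(r x) ^ 4 * (r x * dQ x) \<le> (r x) ^ 4 * (5 * Q x * dr x)"
      using gs by (intro mult_left_mono) auto
    then show "0 \<le> (5 * (r x) ^ 4 * dr x * Q x - (r x) ^ 5 * dQ x) / (Q x)\<^sup>2"
      by (intro divide_nonneg_nonneg) (simp_all add: eval_nat_numeral mult_ac)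
  qed
  \<comment> \<open>From \<open>s0\<close> on, r^5 \<ge> c Q, so the monotone and unbounded growth
    of Q passes to r^5.\<close>
  define c where "c = (r s0) ^ 5 / Q s0"
  have c: "c > 0" using good_r(2)[OF always_good[OF s0(1)]] s0 by (simp add: c_def)
  have "filterlim (\<lambda>s. (r s) ^ 5) at_top (param_end b)"
    unfolding filterlim_at_top
  proof
    fix Z
    obtain s1 where s1: "s1 \<in> params b" "Q s1 > Z / c"
      using unbdd by (auto simp: bdd_above_def not_le)
    have *: "max s0 s1 \<in> params b" using s0 s1 by (auto simp: max_def)
    show "\<forall>\<^sub>F s in param_end b. Z \<le> (r s) ^ 5"
    proof (rule eventually_param_end[OF *])
      fix s assume s: "s \<in> params b" "max s0 s1 \<le> s"
      have "c \<le> (r s) ^ 5 / Q s" using power[OF s0(1) s(1)] s by (simp add: c_def)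
      then have "c * Q s \<le> (r s) ^ 5" using good_Q(2)[OF always_good[OF s(1)]] by (simp add: field_simps)
      moreover have "Z \<le> c * Q s"
      proof -
        have "Z \<le> c * Q s1" using s1(2) c by (simp add: field_simps)
        also have "\<dots> \<le> c * Q s" using Q_mono[OF s1(1) s(1)] s(2) c by (intro mult_left_mono) auto
        finally show ?thesis .
      qed
      ultimately show "Z \<le> (r s) ^ 5" by simp
    qed
  qed
  then show ?thesis
    unfolding filterlim_at_top
  proof (intro allI)
    fix Z assume lim: "\<forall>Z. \<forall>\<^sub>F s in param_end b. Z \<le> (r s) ^ 5"
    have "\<forall>\<^sub>F s in param_end b. r s > 0"
      using good_r(2) always_good by (intro eventually_param_end[OF zero_in_params[OF b_pos]]) blast
    with lim[rule_format, of "\<bar>Z\<bar> ^ 5"] show "\<forall>\<^sub>F s in param_end b. Z \<le> r s"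
    proof eventually_elim
      case (elim s)
      then have "\<bar>Z\<bar> \<le> r s" using power_mono_iff[of "\<bar>Z\<bar>" "r s" 5] by simp
      then show ?case by simp
    qed
  qed
qed

end

section \<open>The geodesic equation with lowered index\<close>

text \<open>Lowering the upper index cancels the inverse matrix and leaves the Christoffel symbols
  of the first kind.\<close>

lemma christoffel_lowered:
  fixes G :: "real^'i \<Rightarrow> real^'i^'i::finite"
  assumes "invertible (G z)"
  shows "(\<Sum>k\<in>UNIV. G z $ l $ k * christoffel G z k i j) =
    (1 / 2) * (partial i (\<lambda>w. G w $ j $ l) z + partial j (\<lambda>w. G w $ i $ l) z - partial l (\<lambda>w. G w $ i $ j) z)"
proof -
  define H where "H m = partial i (\<lambda>w. G w $ j $ m) z + partial j (\<lambda>w. G w $ i $ m) z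
      - partial m (\<lambda>w. G w $ i $ j) z" for m
  have inv: "(\<Sum>k\<in>UNIV. G z $ l $ k * matrix_inv (G z) $ k $ m) = (if l = m then 1 else 0)" for m
  proof -
    have "(G z ** matrix_inv (G z)) $ l $ m = (mat 1 :: real^'i^'i) $ l $ m"
      using someI_ex[OF assms[unfolded invertible_def]] by (simp add: matrix_inv_def)
    then show ?thesis by (simp add: matrix_matrix_mult_def mat_def)
  qed
  have "(\<Sum>k\<in>UNIV. G z $ l $ k * christoffel G z k i j) =
    (\<Sum>k\<in>UNIV. \<Sum>m\<in>UNIV. (1 / 2) * ((G z $ l $ k * matrix_inv (G z) $ k $ m) * H m))"
    by (simp add: christoffel_def H_def sum_distrib_left mult_ac)
  also have "\<dots> = (\<Sum>m\<in>UNIV. \<Sum>k\<in>UNIV. (1 / 2) * ((G z $ l $ k * matrix_inv (G z) $ k $ m) * H m))"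
    by (rule sum.swap)
  also have "\<dots> = (1 / 2) * (\<Sum>m\<in>UNIV. (\<Sum>k\<in>UNIV. G z $ l $ k * matrix_inv (G z) $ k $ m) * H m)"
    by (simp only: sum_distrib_left sum_distrib_right)
  also have "\<dots> = (1 / 2) * H l"
    unfolding inv by (simp add: if_distrib[of "\<lambda>x. x * _"] cong: if_cong)
  finally show ?thesis by (simp add: H_def)
qed

text \<open>With \<open>a\<close> the acceleration, the left side is the derivative of the lowered
  velocity along the curve. Contracted with the symmetric product of velocities, the two terms that
  do not differentiate along \<open>l\<close> coincide and cancel the derivative of the metric; only
  half of the third survives.\<close>

lemma christoffel_lowered_contraction:
  fixes G :: "real^'i \<Rightarrow> real^'i^'i::finite"
  assumes "invertible (G z)" and sym: "\<And>l i j. partial l (\<lambda>w. G w $ i $ j) z = partial l (\<lambda>w. G w $ j $ i) z"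
    and geo: "\<And>k. a $ k + (\<Sum>i\<in>UNIV. \<Sum>j\<in>UNIV. christoffel G z k i j * v $ i * v $ j) = 0"
  shows "(\<Sum>k\<in>UNIV. (\<Sum>j\<in>UNIV. v $ j * partial j (\<lambda>w. G w $ l $ k) z) * v $ k + G z $ l $ k * a $ k) =
    (1 / 2) * (\<Sum>i\<in>UNIV. \<Sum>j\<in>UNIV. partial l (\<lambda>w. G w $ i $ j) z * v $ i * v $ j)"
proof -
  let ?D = "\<lambda>m i j. partial m (\<lambda>w. G w $ i $ j) z"
  have a: "a $ k = - (\<Sum>i\<in>UNIV. \<Sum>j\<in>UNIV. christoffel G z k i j * v $ i * v $ j)" for k
    using geo[of k] by linarith
  have "(\<Sum>k\<in>UNIV. G z $ l $ k * a $ k) =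
    - (\<Sum>k\<in>UNIV. \<Sum>i\<in>UNIV. \<Sum>j\<in>UNIV. (G z $ l $ k * christoffel G z k i j) * v $ i * v $ j)"
    by (simp add: a sum_negf sum_distrib_left mult_ac)
  also have "\<dots> = - (\<Sum>i\<in>UNIV. \<Sum>j\<in>UNIV. \<Sum>k\<in>UNIV. (G z $ l $ k * christoffel G z k i j) * v $ i * v $ j)"
    by (subst sum.swap) (subst sum.swap[of _ UNIV UNIV], simp)
  also have "\<dots> = - (\<Sum>i\<in>UNIV. \<Sum>j\<in>UNIV. (1 / 2) * (?D i j l + ?D j i l - ?D l i j) * v $ i * v $ j)"
    by (simp only: sum_distrib_right[symmetric] christoffel_lowered[of G, OF assms(1)])
  also have "\<dots> = (1 / 2) * (\<Sum>i\<in>UNIV. \<Sum>j\<in>UNIV. ?D l i j * v $ i * v $ j)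
      - (1 / 2) * (\<Sum>i\<in>UNIV. \<Sum>j\<in>UNIV. ?D i j l * v $ i * v $ j)
      - (1 / 2) * (\<Sum>i\<in>UNIV. \<Sum>j\<in>UNIV. ?D j i l * v $ i * v $ j)"
    by (simp add: sum_distrib_left sum_subtractf[symmetric] sum_negf[symmetric] algebra_simps)
  also have "(\<Sum>i\<in>UNIV. \<Sum>j\<in>UNIV. ?D i j l * v $ i * v $ j) = (\<Sum>i\<in>UNIV. \<Sum>j\<in>UNIV. ?D j i l * v $ i * v $ j)"
    by (subst sum.swap) (simp add: mult_ac)
  finally have 1: "(\<Sum>k\<in>UNIV. G z $ l $ k * a $ k) =
      (1 / 2) * (\<Sum>i\<in>UNIV. \<Sum>j\<in>UNIV. ?D l i j * v $ i * v $ j)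
      - (\<Sum>i\<in>UNIV. \<Sum>j\<in>UNIV. ?D j i l * v $ i * v $ j)" by simp
  have "(\<Sum>k\<in>UNIV. (\<Sum>j\<in>UNIV. v $ j * ?D j l k) * v $ k) = (\<Sum>i\<in>UNIV. \<Sum>j\<in>UNIV. ?D j i l * v $ i * v $ j)"
    unfolding sym[of _ l] by (simp add: sum_distrib_right sum_distrib_left mult_ac)
  with 1 show ?thesis by (simp add: sum.distrib)
qed

text \<open>No element of \<open>params b\<close> is isolated, since b lies strictly above each;
  this makes velocities unique, also the one-sided one at 0.\<close>

lemma at_within_params_nontrivial:
  assumes "s \<in> params b"
  shows "at s within params b \<noteq> bot"
proof -
  obtain t where t: "ereal s < ereal t" "ereal t < b"
    using assms ereal_dense2[of "ereal s" b] by (auto simp: params_def)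
  then have "s < t" by simp
  moreover have "t \<in> params b" using t assms by (auto simp: params_def)
  ultimately have "{s..t} \<subseteq> params b" using between_params[OF assms] by auto
  then have "at s within {s..t} \<le> at s within params b" by (rule at_le)
  moreover have "at s within {s..t} \<noteq> bot"
    using \<open>s < t\<close> by (simp add: at_within_Icc_at_right)
  ultimately show ?thesis using bot.extremum_uniqueI by metis
qed

lemma velocity_eq:
  "s \<in> params b \<Longrightarrow> (f has_vector_derivative d) (at s within params b) \<Longrightarrow> velocity f b s = d"
  unfolding velocity_def using at_within_params_nontrivial vector_derivative_within by blast

lemma has_velocity:
  "f differentiable (at s within params b) \<Longrightarrow> (f has_vector_derivative velocity f b s) (at s within params b)"
  unfolding velocity_def by (simp add: vector_derivative_works)

lemma partial_cong:
  assumes "open S" "z \<in> S" "\<And>w. w \<in> S \<Longrightarrow> f w = f' w"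
  shows "partial i f z = partial i f' z"
proof -
  have "(f has_derivative D) (at z) \<longleftrightarrow> (f' has_derivative D) (at z)" for D
    using assms by (metis has_derivative_transform_within_open)
  then show ?thesis by (simp add: partial_def frechet_derivative_def)
qed

section \<open>Nondegeneracy of the Bondi metric and momenta of geodesics\<close>

context bondi_asymptotically_flat
begin

lemma g_apply:
  "g (u, r, x) (a, k, v) (a', k', v') =
     - A u r x * exp (B u r x) * a * a' - exp (B u r x) * (a * k' + a' * k)
     + r\<^sup>2 * h u r x (v + a *\<^sub>R C u r x) (v' + a' *\<^sub>R C u r x)"
  by (simp add: g_def bondi_metric_def)

lemma g_sym: "p \<in> region T R0 \<Longrightarrow> g p v w = g p w v"
  by (cases p; cases v; cases w) (simp add: g_apply h_sym mult_ac add.commute)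

lemma bilinear_g:
  assumes "p \<in> region T R0"
  shows "bilinear (g p)"
proof -
  obtain u r x where p: "p = (u, r, x)" by (cases p)
  note h = h_bilinear[OF assms[unfolded p]]
  have lin: "linear (\<lambda>w. g p v w)" for v
  proof (rule linearI)
    obtain a k vv where v: "v = (a, k, vv)" by (cases v)
    show "g p v (w + w') = g p v w + g p v w'" for w w'
    proof -
      obtain a1 k1 v1 a2 k2 v2 where w: "w = (a1, k1, v1)" "w' = (a2, k2, v2)" by (cases w; cases w')
      show ?thesis by (simp add: w p v g_apply scaleR_left_distrib bilinear_ladd[OF h] bilinear_radd[OF h]
          bilinear_lmul[OF h] bilinear_rmul[OF h] algebra_simps)
    qed
    show "g p v (c *\<^sub>R w) = c *\<^sub>R g p v w" for c w
    proof -
      obtain a1 k1 v1 where w: "w = (a1, k1, v1)" by (cases w)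
      show ?thesis by (simp add: w p v g_apply bilinear_ladd[OF h] bilinear_radd[OF h]
          bilinear_lmul[OF h] bilinear_rmul[OF h] algebra_simps)
    qed
  qed
  moreover have "(\<lambda>w. g p w v) = (\<lambda>w. g p v w)" for v
    using g_sym[OF assms] by blast
  ultimately show ?thesis by (simp add: bilinear_def)
qed

text \<open>The differential of \<open>event_of c\<close> at \<open>z\<close>: it turns a coordinate
  velocity into a vector of the surrounding space that can be compared between charts.\<close>

definition tangent :: "bool \<Rightarrow> real^('n coord) \<Rightarrow> real^('n coord) \<Rightarrow> 'n event" where
  "tangent c z v = (v $ Ucoord, v $ Rcoord, dstereo c (angles z) (angles v))"

lemma has_derivative_tangent: "(event_of c has_derivative tangent c z) (at z)"
  unfolding tangent_def[abs_def] by (rule has_derivative_event_of)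

lemma tangent_eq_sum: "tangent c z v = (\<Sum>i\<in>UNIV. v $ i *\<^sub>R partial i (event_of c) z)"
proof -
  have "linear (tangent c z)" using has_derivative_tangent has_derivative_linear by blast
  moreover have "partial i (event_of c) z = tangent c z (axis i 1)" for i
    by (rule partial_eq[OF has_derivative_tangent])
  ultimately show ?thesis
    by (subst basis_expansion[symmetric, of v]) (simp add: linear_sum linear_cmul scalar_mult_eq_scaleR)
qed

lemma metric_comp_sum:
  assumes "z \<in> coord_region T R0"
  shows "g (event_of c z) (tangent c z v) (tangent c z w) =
    (\<Sum>i\<in>UNIV. \<Sum>j\<in>UNIV. metric_comp g c z $ i $ j * v $ i * w $ j)"
    and "g (event_of c z) (partial l (event_of c) z) (tangent c z w) =
    (\<Sum>j\<in>UNIV. metric_comp g c z $ l $ j * w $ j)"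
proof -
  note b = bilinear_g[OF event_of_in_region[OF assms]]
  have lin: "linear (g (event_of c z) v)" for v using b unfolding bilinear_def by blast
  show 2: "g (event_of c z) (partial l (event_of c) z) (tangent c z w) =
    (\<Sum>j\<in>UNIV. metric_comp g c z $ l $ j * w $ j)" for l
    unfolding tangent_eq_sum by (simp add: linear_sum[OF lin] linear_cmul[OF lin] metric_comp_def mult_ac)
  have lin': "linear (\<lambda>v. g (event_of c z) v w)" for w using b unfolding bilinear_def by blast
  show "g (event_of c z) (tangent c z v) (tangent c z w) =
    (\<Sum>i\<in>UNIV. \<Sum>j\<in>UNIV. metric_comp g c z $ i $ j * v $ i * w $ j)"
    unfolding tangent_eq_sum[of c z v]
    by (simp add: linear_sum[OF lin'] linear_cmul[OF lin'] 2 sum_distrib_left mult_ac)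
qed

lemma metric_comp_sym:
  "z \<in> coord_region T R0 \<Longrightarrow> metric_comp g c z $ i $ j = metric_comp g c z $ j $ i"
  by (simp add: metric_comp_def g_sym[OF event_of_in_region])

text \<open>Justifies the \<open>matrix_inv\<close> inside \<open>christoffel\<close>. A kernel
  vector loses its components one by one: u by pairing with the r-direction, then the angles by
  positivity of \<open>h\<close>, and finally r by pairing with the u-direction.\<close>

lemma invertible_metric_comp:
  assumes z: "z \<in> coord_region T R0"
  shows "invertible (metric_comp g c z)"
proof -
  have "v = 0" if v: "metric_comp g c z *v v = 0" for v
  proof -
    obtain u r x where p: "event_of c z = (u, r, x)" by (cases "event_of c z")
    have reg: "(u, r, x) \<in> region T R0" using event_of_in_region[OF z, of c] by (simp add: p)
    then have "r > 0" using R0_nonneg by (simp add: region_def)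
    note hb = h_bilinear[OF reg]
    have g0: "g (event_of c z) (partial l (event_of c) z) (tangent c z v) = 0" for l
      using arg_cong[OF v, of "\<lambda>v. v $ l"] by (simp add: metric_comp_sum(2)[OF z] matrix_vector_mult_def)
    have vU: "v $ Ucoord = 0"
      using g0[of Rcoord] bilinear_lzero[OF hb] by (simp add: partial_event_of tangent_def p g_apply)
    let ?X = "dstereo c (angles z) (angles v)"
    have orth: "?X \<bullet> x = 0"
      using p stereo_inv_orthogonal_dstereo by (auto simp: event_of_def)
    \<comment> \<open>Pairing the kernel vector with its own angular part; since its u-component
      vanishes, this yields \<open>h\<close> on the diagonal, where positivity applies.\<close>
    have "g (event_of c z) (0, 0, ?X) (tangent c z v) = 0"
    proof -
      have eq: "(0, 0, ?X) = (\<Sum>I\<in>UNIV. v $ Angle I *\<^sub>R partial (Angle I) (event_of c) z)"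
        by (simp add: partial_event_of dstereo_eq_sum sum_prod angles_def zero_prod_def prod_eq_iff fst_sum snd_sum)
      have lin': "linear (\<lambda>w. g (event_of c z) w (tangent c z v))"
        using bilinear_g[OF event_of_in_region[OF z]] unfolding bilinear_def by blast
      show ?thesis unfolding eq by (simp add: linear_sum[OF lin'] linear_cmul[OF lin'] g0)
    qed
    then have "h u r x ?X ?X = 0"
      using \<open>r > 0\<close> by (simp add: p tangent_def g_apply vU)
    then have "?X = 0" using h_pos[OF reg orth] by force
    then have "angles v = 0"
      using norm_dstereo[of c "angles z" "angles v"] inner_self_plus_1[of "angles z"] by simp
    moreover have "v $ Rcoord = 0"
      using g0[of Ucoord] \<open>?X = 0\<close> bilinear_rzero[OF hb]
      by (simp add: partial_event_of tangent_def p g_apply vU)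
    ultimately have "v $ i = 0" for i
      using vU by (cases i) (auto simp: angles_def vec_eq_iff)
    then show "v = 0" by (simp add: vec_eq_iff)
  qed
  then have "\<exists>B. B ** metric_comp g c z = mat 1"
    using matrix_left_invertible_ker by blast
  then show ?thesis by (simp add: invertible_left_inverse)
qed

lemma open_coord_region: "open (coord_region T R0 :: (real^('n coord)) set)"
proof -
  have "open ((\<lambda>z. z $ Ucoord) -` T \<inter> (\<lambda>z. z $ Rcoord) -` {R0<..} :: (real^('n coord)) set)"
    using u_range(1) by (intro open_Int open_vimage) (auto intro!: continuous_intros)
  also have "(\<lambda>z. z $ Ucoord) -` T \<inter> (\<lambda>z. z $ Rcoord) -` {R0<..} = (coord_region T R0 :: (real^('n coord)) set)"
    by (auto simp: coord_region_def)
  finally show ?thesis .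
qed

lemma partial_metric_comp_sym:
  assumes "z \<in> coord_region T R0"
  shows "partial l (\<lambda>w. metric_comp g c w $ i $ j) z = partial l (\<lambda>w. metric_comp g c w $ j $ i) z"
  by (rule partial_cong[OF open_coord_region assms metric_comp_sym])

context
  fixes b :: ereal and \<gamma> :: "real \<Rightarrow> 'n event"
  assumes geo: "geodesic g b \<gamma>" and reg: "\<gamma> ` params b \<subseteq> region T R0"
begin

text \<open>Passes from a chart to the curve in the surrounding space. Continuity of
  \<open>\<gamma>\<close> keeps nearby parameters inside the chart, so derivatives computed there
  are derivatives of \<open>\<gamma>\<close>.\<close>

lemma chart_velocity:
  assumes s: "s \<in> params b" and ch: "\<gamma> s \<in> chart_domain c"
  defines "z \<equiv> \<lambda>t. coords_of c (\<gamma> t)"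
  shows "(\<gamma> has_vector_derivative tangent c (z s) (velocity z b s)) (at s within params b)"
    and "\<exists>d>0. \<forall>t\<in>params b. dist t s < d \<longrightarrow> \<gamma> t \<in> chart_domain c"
    and "(z has_vector_derivative velocity z b s) (at s within params b)"
    and "(velocity z b has_vector_derivative velocity (velocity z b) b s) (at s within params b)"
    and "velocity (velocity z b) b s $ k + (\<Sum>i\<in>UNIV. \<Sum>j\<in>UNIV.
           christoffel (metric_comp g c) (z s) k i j * velocity z b s $ i * velocity z b s $ j) = 0"
proof -
  show dz: "(z has_vector_derivative velocity z b s) (at s within params b)"
    and "(velocity z b has_vector_derivative velocity (velocity z b) b s) (at s within params b)"
    and "velocity (velocity z b) b s $ k + (\<Sum>i\<in>UNIV. \<Sum>j\<in>UNIV.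
           christoffel (metric_comp g c) (z s) k i j * velocity z b s $ i * velocity z b s $ j) = 0"
    using geo s ch unfolding geodesic_def Let_def z_def by (blast intro: has_velocity)+
  have "(\<gamma> \<longlongrightarrow> \<gamma> s) (at s within params b)"
    using geo s by (simp add: geodesic_def continuous_on_def)
  from topological_tendstoD[OF this open_chart_domain ch]
  show "\<exists>d>0. \<forall>t\<in>params b. dist t s < d \<longrightarrow> \<gamma> t \<in> chart_domain c"
    unfolding eventually_at using ch by metis
  then obtain d where d: "d > 0" "\<And>t. t \<in> params b \<Longrightarrow> dist t s < d \<Longrightarrow> \<gamma> t \<in> chart_domain c" by blast
  have "((\<lambda>t. event_of c (z t)) has_derivative (\<lambda>h. tangent c (z s) (h *\<^sub>R velocity z b s))) (at s within params b)"
    by (rule has_derivative_compose[OF dz[unfolded has_vector_derivative_def] has_derivative_tangent])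
  then have "((\<lambda>t. event_of c (z t)) has_vector_derivative tangent c (z s) (velocity z b s)) (at s within params b)"
    using linear_cmul[OF has_derivative_linear[OF has_derivative_tangent]]
    unfolding has_vector_derivative_def by simp
  then show "(\<gamma> has_vector_derivative tangent c (z s) (velocity z b s)) (at s within params b)"
    by (rule has_vector_derivative_transform_within[OF _ d(1) s])
      (use d(2) reg in \<open>auto simp: z_def intro: event_of_coords_of\<close>)
qed

lemma momentum_chart:
  assumes s: "s \<in> params b" and ch: "\<gamma> s \<in> chart_domain c"
  defines "z \<equiv> \<lambda>t. coords_of c (\<gamma> t)"
  shows "g (\<gamma> s) (partial l (event_of c) (z s)) (velocity \<gamma> b s) =
    (\<Sum>k\<in>UNIV. metric_comp g c (z s) $ l $ k * velocity z b s $ k)"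
proof -
  have p: "\<gamma> s \<in> region T R0" using reg s by auto
  have "g (event_of c (z s)) (partial l (event_of c) (z s)) (tangent c (z s) (velocity z b s)) =
    (\<Sum>k\<in>UNIV. metric_comp g c (z s) $ l $ k * velocity z b s $ k)"
    unfolding z_def by (rule metric_comp_sum(2)[OF coords_of_in_coord_region[OF p]])
  then show ?thesis
    using velocity_eq[OF s chart_velocity(1)[OF s ch]] event_of_coords_of[OF p ch]
    by (simp add: z_def)
qed

text \<open>For the u- and r-directions the frame vector is constant and the same in both charts by
  \<open>partial_event_of\<close>, so the differentiated function is then independent of
  \<open>c\<close>.\<close>

lemma momentum_derivative:
  assumes s: "s \<in> params b" and ch: "\<gamma> s \<in> chart_domain c"
  defines "z \<equiv> \<lambda>t. coords_of c (\<gamma> t)"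
  shows "((\<lambda>t. g (\<gamma> t) (partial l (event_of c) (z t)) (velocity \<gamma> b t)) has_real_derivative
    (1 / 2) * (\<Sum>i\<in>UNIV. \<Sum>j\<in>UNIV. partial l (\<lambda>w. metric_comp g c w $ i $ j) (z s)
      * velocity z b s $ i * velocity z b s $ j)) (at s within params b)"
proof -
  note cv = chart_velocity[OF s ch, folded z_def]
  have zs: "z s \<in> coord_region T R0"
    unfolding z_def by (rule coords_of_in_coord_region) (use reg s in auto)
  obtain d where d: "d > 0" "\<And>t. t \<in> params b \<Longrightarrow> dist t s < d \<Longrightarrow> \<gamma> t \<in> chart_domain c"
    using cv(2) by blast
  let ?v = "velocity z b" and ?a = "velocity (velocity z b) b"
  have dG: "((\<lambda>t. metric_comp g c (z t) $ l $ k) has_vector_derivative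
      (\<Sum>j\<in>UNIV. ?v s $ j * partial j (\<lambda>w. metric_comp g c w $ l $ k) (z s))) (at s within params b)" for k
  proof -
    have "(\<lambda>w. metric_comp g c w $ l $ k) differentiable (at (z s))"
      using regular zs by (simp add: C11_on_def)
    from has_derivative_compose[OF cv(3)[unfolded has_vector_derivative_def] has_derivative_partials[OF this]]
    show ?thesis by (simp add: has_vector_derivative_def sum_distrib_left mult.assoc)
  qed
  have dv: "((\<lambda>t. ?v t $ k) has_vector_derivative ?a s $ k) (at s within params b)" for k
    by (rule bounded_linear.has_vector_derivative[OF bounded_linear_vec_nth cv(4)])
  have geo_z: "?a s $ k + (\<Sum>i\<in>UNIV. \<Sum>j\<in>UNIV.
      christoffel (metric_comp g c) (z s) k i j * ?v s $ i * ?v s $ j) = 0" for k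
    unfolding z_def by (rule chart_velocity(5)[OF s ch])
  have "((\<lambda>t. \<Sum>k\<in>UNIV. metric_comp g c (z t) $ l $ k * ?v t $ k) has_real_derivative
      (\<Sum>k\<in>UNIV. (\<Sum>j\<in>UNIV. ?v s $ j * partial j (\<lambda>w. metric_comp g c w $ l $ k) (z s)) * ?v s $ k
        + metric_comp g c (z s) $ l $ k * ?a s $ k)) (at s within params b)"
    using dG dv unfolding has_real_derivative_iff_has_vector_derivative[symmetric]
    by (intro DERIV_sum) (rule derivative_eq_intros refl | assumption | simp)+
  also have "(\<Sum>k\<in>UNIV. (\<Sum>j\<in>UNIV. ?v s $ j * partial j (\<lambda>w. metric_comp g c w $ l $ k) (z s)) * ?v s $ k
        + metric_comp g c (z s) $ l $ k * ?a s $ k) =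
    (1 / 2) * (\<Sum>i\<in>UNIV. \<Sum>j\<in>UNIV. partial l (\<lambda>w. metric_comp g c w $ i $ j) (z s) * ?v s $ i * ?v s $ j)"
    by (rule christoffel_lowered_contraction[OF invertible_metric_comp[OF zs] partial_metric_comp_sym[OF zs] geo_z])
  finally show ?thesis
    unfolding has_real_derivative_iff_has_vector_derivative
    by (rule has_vector_derivative_transform_within[OF _ d(1) s])
      (use d(2) momentum_chart in \<open>auto simp: z_def\<close>)
qed

end

end

section \<open>Estimates for the metric and its derivatives\<close>

lemma abs_sum_component_le:
  fixes w :: "real^'n::finite"
  assumes "\<And>I. \<bar>f I\<bar> \<le> K"
  shows "\<bar>\<Sum>I\<in>UNIV. f I * w $ I\<bar> \<le> K * real CARD('n) * norm w"
proof -
  have "\<bar>\<Sum>I\<in>UNIV. f I * w $ I\<bar> \<le> (\<Sum>I\<in>(UNIV::'n set). K * norm w)"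
    by (rule order_trans[OF sum_abs], rule sum_mono)
      (use assms component_le_norm_cart in \<open>auto simp: abs_mult intro!: mult_mono intro: order_trans[OF abs_ge_zero assms]\<close>)
  then show ?thesis by (simp add: mult_ac)
qed

lemma abs_double_sum_component_le:
  fixes w :: "real^'n::finite"
  assumes "\<And>I J. \<bar>f I J\<bar> \<le> K"
  shows "\<bar>\<Sum>I\<in>UNIV. \<Sum>J\<in>UNIV. f I J * w $ I * w $ J\<bar> \<le> K * (real CARD('n))\<^sup>2 * (norm w)\<^sup>2"
proof -
  have "(\<Sum>I\<in>UNIV. \<Sum>J\<in>UNIV. f I J * w $ I * w $ J) = (\<Sum>I\<in>UNIV. (\<Sum>J\<in>UNIV. f I J * w $ J) * w $ I)"
    by (simp add: sum_distrib_left sum_distrib_right mult_ac)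
  moreover have "\<bar>\<Sum>J\<in>UNIV. f I J * w $ J\<bar> \<le> K * real CARD('n) * norm w" for I
    by (rule abs_sum_component_le) (rule assms)
  from abs_sum_component_le[OF this]
  have "\<bar>\<Sum>I\<in>UNIV. (\<Sum>J\<in>UNIV. f I J * w $ J) * w $ I\<bar> \<le> K * real CARD('n) * norm w * real CARD('n) * norm w" .
  ultimately show ?thesis by (simp add: power2_eq_square mult_ac)
qed

lemma quadratic_form_coord:
  fixes H :: "'n::finite coord \<Rightarrow> 'n coord \<Rightarrow> real"
  assumes "\<And>i j. H i j = H j i" "H Rcoord Rcoord = 0" "\<And>I. H Rcoord (Angle I) = 0"
  shows "(\<Sum>i\<in>UNIV. \<Sum>j\<in>UNIV. H i j * v $ i * v $ j) =
    H Ucoord Ucoord * (v $ Ucoord)\<^sup>2 + 2 * H Ucoord Rcoord * v $ Ucoord * v $ Rcoord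
    + 2 * v $ Ucoord * (\<Sum>I\<in>UNIV. H Ucoord (Angle I) * angles v $ I)
    + (\<Sum>I\<in>UNIV. \<Sum>J\<in>UNIV. H (Angle I) (Angle J) * angles v $ I * angles v $ J)"
  using assms(2,3) assms(1)[of "Angle _" Ucoord] assms(1)[of "Angle _" Rcoord] assms(1)[of Rcoord Ucoord]
  by (simp add: sum_coord sum.distrib sum_distrib_left angles_def power2_eq_square algebra_simps)

text \<open>Since \<open>order_drop\<close> can only improve the order, the single exponent
  \<open>q'\<close> serves the derivatives in all directions.\<close>

lemma diff_bigo_imp_small:
  fixes E :: "bool \<Rightarrow> real^('n::finite coord) \<Rightarrow> real"
  assumes "diff_bigo T R0 p E" "p < q" "p < q'" "\<eta> > 0"
  shows "eventually (\<lambda>z. \<forall>c. \<bar>E c z\<bar> \<le> \<eta> * (z $ Rcoord) powr q \<and>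
    (\<forall>l. \<bar>partial l (E c) z\<bar> \<le> \<eta> * (z $ Rcoord) powr q')) (scri T)"
proof -
  have "partial l (E c) \<in> O[scri T](\<lambda>z. (z $ Rcoord) powr (p - order_drop l))"
    "E c \<in> O[scri T](\<lambda>z. (z $ Rcoord) powr p)" for c l
    using assms(1) unfolding diff_bigo_iff by blast+
  moreover have "p - order_drop l < q'" for l :: "'n coord"
    using assms(3) by (simp add: order_drop_def)
  ultimately have "eventually (\<lambda>z. \<bar>E c z\<bar> \<le> \<eta> * (z $ Rcoord) powr q) (scri T)"
    and "eventually (\<lambda>z. \<bar>partial l (E c) z\<bar> \<le> \<eta> * (z $ Rcoord) powr q') (scri T)" for c l
    using bigo_scri_imp_small assms(2,4) by blast+
  then show ?thesis
    by (intro eventually_all_finite eventually_conj)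
qed

lemma sphere_comp_inner: "sphere_comp inner c y $ I $ J = (2 / (y \<bullet> y + 1))\<^sup>2 * (if I = J then 1 else 0)"
  by (simp add: sphere_comp_def sphere_frame_eq inner_dstereo inner_axis_axis)

section \<open>Approach of the metric to the flat one\<close>

context bondi_asymptotically_flat
begin

text \<open>The exponents of the uu, uI and IJ components are those of the leading corrections at n
  = 5, the worst case. They lie strictly below -1, 0 and 1, the orders at which r times a derivative
  would be comparable to the flat scale; for n = 4 the leading terms would sit exactly at these
  orders.\<close>

lemma diff_bigo_metric:
  assumes "n \<ge> 5"
  shows "diff_bigo T R0 (- (3/2)) (\<lambda>c z. metric_comp g c z $ Ucoord $ Ucoord - (- 1))" (is ?UU)
    and "diff_bigo T R0 (- (3/2)) (\<lambda>c z. metric_comp g c z $ Ucoord $ Rcoord - (- 1))" (is ?UR)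
    and "diff_bigo T R0 (- (1/2)) (\<lambda>c z. metric_comp g c z $ Ucoord $ Angle I)" (is ?UI)
    and "diff_bigo T R0 (1/2) (\<lambda>c z. metric_comp g c z $ Angle I $ Angle J
      - round_comp c (angles z) $ I $ J * (z $ Rcoord)\<^sup>2)" (is ?IJ)
proof -
  have N: "N \<ge> 5" and \<delta>: "\<delta> \<ge> 0" using assms by (auto simp: N_def \<delta>_def)
  note add_term = diff_bigo_diff_powr[OF R0_nonneg]
  have "diff_bigo T R0 (- (3/2)) (\<lambda>c z. metric_comp g c z $ Ucoord $ Ucoord -
      (- 1 - A1 (z $ Ucoord) (stereo_inv c (angles z)) * (z $ Rcoord) powr (- (N / 2 - 1))))"
    by (rule add_term[OF g_uu m_bounded]) (use N \<delta> in \<open>simp_all add: field_simps\<close>)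
  then have "diff_bigo T R0 (- (3/2)) (\<lambda>c z. metric_comp g c z $ Ucoord $ Ucoord -
      (- 1 + (- 1 * A1 (z $ Ucoord) (stereo_inv c (angles z))) * (z $ Rcoord) powr (- (N / 2 - 1))))"
    by simp
  then show ?UU
    by (rule add_term[OF _ diff_bigo_scale[OF A1_bounded]]) (use N in simp_all)
  have "diff_bigo T R0 (- (N - 3 / 2) - \<delta>) (\<lambda>c z. metric_comp g c z $ Ucoord $ Rcoord -
      (- 1 + (- 1 * B1 (z $ Ucoord) (stereo_inv c (angles z))) * (z $ Rcoord) powr (- (N - 2))))"
    using g_ur by simp
  then show ?UR
    by (rule add_term[OF _ diff_bigo_scale[OF B1_bounded]]) (use N \<delta> in simp_all)
  have "diff_bigo T R0 (- (N - 3) / 2 - \<delta>) (\<lambda>c z. metric_comp g c z $ Ucoord $ Angle I -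
      (0 + C1 (z $ Ucoord) (stereo_inv c (angles z)) (sphere_frame c (angles z) I)
        * (z $ Rcoord) powr (- (N / 2 - 2))))"
    using g_uI by simp
  from add_term[OF this C1_bounded, of "- (1/2)"] show ?UI
    using N \<delta> by (simp add: field_simps)
  show ?IJ
    by (rule add_term[OF g_IJ h1_bounded]) (use N \<delta> in \<open>simp_all add: field_simps\<close>)
qed

lemma metric_comp_R:
  assumes "z \<in> coord_region T R0"
  shows "metric_comp g c z $ Rcoord $ Rcoord = 0" "metric_comp g c z $ Rcoord $ Angle I = 0"
proof -
  obtain u r x where p: "event_of c z = (u, r, x)" by (cases "event_of c z")
  have "(u, r, x) \<in> region T R0" using event_of_in_region[OF assms, of c] by (simp add: p)
  note hb = h_bilinear[OF this]
  show "metric_comp g c z $ Rcoord $ Rcoord = 0" "metric_comp g c z $ Rcoord $ Angle I = 0"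
    by (simp_all add: metric_comp_def partial_event_of p g_apply bilinear_lzero[OF hb])
qed

lemma partial_const: "partial l (\<lambda>w. k) z = 0"
  by (simp add: partial_eq[OF has_derivative_const])

lemma partial_metric_comp_R:
  assumes "z \<in> coord_region T R0"
  shows "partial l (\<lambda>w. metric_comp g c w $ Rcoord $ Rcoord) z = 0"
    "partial l (\<lambda>w. metric_comp g c w $ Rcoord $ Angle I) z = 0"
  by (subst partial_cong[OF open_coord_region assms, where f' = "\<lambda>w. 0"];
      simp add: metric_comp_R partial_const)+

lemma metric_comp_differentiable:
  "z \<in> coord_region T R0 \<Longrightarrow> (\<lambda>w. metric_comp g c w $ i $ j) differentiable (at z)"
  using regular by (simp add: C11_on_def)

lemma partial_diff_const:
  assumes "f differentiable (at z)"
  shows "partial l (\<lambda>w. f w - k) z = partial l f z"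
  using partial_eq[OF has_derivative_diff[OF has_frechet_derivative[OF assms] has_derivative_const]]
  by (simp add: partial_def)

lemma has_derivative_round_comp:
  "((\<lambda>w. round_comp c (angles w) $ I $ J * (w $ Rcoord)\<^sup>2) has_derivative
    (\<lambda>v. (2 / (angles z \<bullet> angles z + 1))\<^sup>2 * (if I = J then 1 else 0) * (2 * (z $ Rcoord) * v $ Rcoord)
      - 16 * (angles z \<bullet> angles v) / (angles z \<bullet> angles z + 1) ^ 3 * (if I = J then 1 else 0) * (z $ Rcoord)\<^sup>2)) (at z)"
proof -
  have pos: "angles z \<bullet> angles z + 1 \<noteq> 0" by (rule inner_self_plus_1)
  have a: "(angles has_derivative angles) (at z)"
    by (rule bounded_linear_imp_has_derivative[OF bounded_linear_angles])
  have r: "((\<lambda>w. w $ Rcoord) has_derivative (\<lambda>v. v $ Rcoord)) (at z)"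
    by (rule bounded_linear_imp_has_derivative[OF bounded_linear_vec_nth])
  show ?thesis
    unfolding sphere_comp_inner
    by (rule derivative_eq_intros a r pos refl)+
      (use pos in \<open>auto simp: fun_eq_iff field_simps power_numeral_reduce inner_commute\<close>)
qed

text \<open>These are the flat values behind \<open>2 * Y\<^sup>2\<close> for \<open>kh\<close> and
  0 for \<open>lh\<close> in \<open>perturbed_null\<close>.\<close>

lemma partial_round_comp:
  "partial Rcoord (\<lambda>w. round_comp c (angles w) $ I $ J * (w $ Rcoord)\<^sup>2) z = 2 * z $ Rcoord * round_comp c (angles z) $ I $ J"
  "partial Ucoord (\<lambda>w. round_comp c (angles w) $ I $ J * (w $ Rcoord)\<^sup>2) z = 0"
proof -
  show "partial Rcoord (\<lambda>w. round_comp c (angles w) $ I $ J * (w $ Rcoord)\<^sup>2) z = 2 * z $ Rcoord * round_comp c (angles z) $ I $ J"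
    by (rule trans[OF partial_eq[OF has_derivative_round_comp]]) (simp add: angles_axis sphere_comp_inner)
  show "partial Ucoord (\<lambda>w. round_comp c (angles w) $ I $ J * (w $ Rcoord)\<^sup>2) z = 0"
    by (rule trans[OF partial_eq[OF has_derivative_round_comp]]) (simp add: angles_axis, simp add: axis_def)
qed

lemma partial_metric_comp_minus_round:
  assumes "z \<in> coord_region T R0"
  shows "partial l (\<lambda>w. metric_comp g c w $ Angle I $ Angle J - round_comp c (angles w) $ I $ J * (w $ Rcoord)\<^sup>2) z =
    partial l (\<lambda>w. metric_comp g c w $ Angle I $ Angle J) z - partial l (\<lambda>w. round_comp c (angles w) $ I $ J * (w $ Rcoord)\<^sup>2) z"
  unfolding partial_eq[OF has_derivative_diff[OF has_frechet_derivative[OF metric_comp_differentiable[OF assms]] has_derivative_round_comp]]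
  by (subst partial_eq[OF has_derivative_round_comp]) (simp only: partial_def)

text \<open>Each angular index is worth one power of r, since |x'| is controlled only through r
  |x'|. Derivatives are multiplied by r to put them on the same scale as the metric.\<close>

lemma metric_near_flat:
  assumes n: "n \<ge> 5" and \<eta>: "\<eta> > 0"
  obtains R1 where "R1 \<ge> 1" "R1 > R0"
    and "\<And>c z. z \<in> coord_region T R0 \<Longrightarrow> z $ Rcoord \<ge> R1 \<Longrightarrow> norm (angles z) \<le> 1 \<Longrightarrow>
      \<bar>metric_comp g c z $ Ucoord $ Ucoord + 1\<bar> \<le> \<eta> \<and> \<bar>metric_comp g c z $ Ucoord $ Rcoord + 1\<bar> \<le> \<eta> \<and>
      (\<forall>I. \<bar>metric_comp g c z $ Ucoord $ Angle I\<bar> \<le> \<eta> * z $ Rcoord) \<and>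
      (\<forall>I J. \<bar>metric_comp g c z $ Angle I $ Angle J - round_comp c (angles z) $ I $ J * (z $ Rcoord)\<^sup>2\<bar> \<le> \<eta> * (z $ Rcoord)\<^sup>2)"
    and "\<And>c l z. z \<in> coord_region T R0 \<Longrightarrow> z $ Rcoord \<ge> R1 \<Longrightarrow> norm (angles z) \<le> 1 \<Longrightarrow>
      \<bar>z $ Rcoord * partial l (\<lambda>w. metric_comp g c w $ Ucoord $ Ucoord) z\<bar> \<le> \<eta> \<and>
      \<bar>z $ Rcoord * partial l (\<lambda>w. metric_comp g c w $ Ucoord $ Rcoord) z\<bar> \<le> \<eta> \<and>
      (\<forall>I. \<bar>z $ Rcoord * partial l (\<lambda>w. metric_comp g c w $ Ucoord $ Angle I) z\<bar> \<le> \<eta> * z $ Rcoord) \<and>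
      (\<forall>I J. \<bar>z $ Rcoord * (partial l (\<lambda>w. metric_comp g c w $ Angle I $ Angle J) z
          - partial l (\<lambda>w. round_comp c (angles w) $ I $ J * (w $ Rcoord)\<^sup>2) z)\<bar> \<le> \<eta> * (z $ Rcoord)\<^sup>2)"
proof -
  note D = diff_bigo_metric[OF n]
  \<comment> \<open>The exponents 0, 1, 2 count angular indices; for derivatives they are one lower,
    to be restored by the factor r.\<close>
  have ev: "eventually (\<lambda>z. 
     (\<forall>c. \<bar>metric_comp g c z $ Ucoord $ Ucoord - (- 1)\<bar> \<le> \<eta> * (z $ Rcoord) powr 0 \<and>
       (\<forall>l. \<bar>partial l (\<lambda>z. metric_comp g c z $ Ucoord $ Ucoord - (- 1)) z\<bar> \<le> \<eta> * (z $ Rcoord) powr (- 1))) \<and>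
     (\<forall>c. \<bar>metric_comp g c z $ Ucoord $ Rcoord - (- 1)\<bar> \<le> \<eta> * (z $ Rcoord) powr 0 \<and>
       (\<forall>l. \<bar>partial l (\<lambda>z. metric_comp g c z $ Ucoord $ Rcoord - (- 1)) z\<bar> \<le> \<eta> * (z $ Rcoord) powr (- 1))) \<and>
     (\<forall>I c. \<bar>metric_comp g c z $ Ucoord $ Angle I\<bar> \<le> \<eta> * (z $ Rcoord) powr 1 \<and>
       (\<forall>l. \<bar>partial l (\<lambda>z. metric_comp g c z $ Ucoord $ Angle I) z\<bar> \<le> \<eta> * (z $ Rcoord) powr 0)) \<and>
     (\<forall>I J c. \<bar>metric_comp g c z $ Angle I $ Angle J - round_comp c (angles z) $ I $ J * (z $ Rcoord)\<^sup>2\<bar> \<le> \<eta> * (z $ Rcoord) powr 2 \<and>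
       (\<forall>l. \<bar>partial l (\<lambda>z. metric_comp g c z $ Angle I $ Angle J - round_comp c (angles z) $ I $ J * (z $ Rcoord)\<^sup>2) z\<bar> \<le> \<eta> * (z $ Rcoord) powr 1)))
    (scri T)"
    by (intro eventually_conj diff_bigo_imp_small[OF D(1)] diff_bigo_imp_small[OF D(2)]
        eventually_all_finite diff_bigo_imp_small[OF D(3)] diff_bigo_imp_small[OF D(4)]) (use \<eta> in simp_all)
  obtain M where M: "\<And>z. z $ Rcoord \<ge> M \<Longrightarrow> z $ Ucoord \<in> T \<Longrightarrow> norm (angles z) \<le> 1 \<Longrightarrow>
     (\<forall>c. \<bar>metric_comp g c z $ Ucoord $ Ucoord - (- 1)\<bar> \<le> \<eta> * (z $ Rcoord) powr 0 \<and>
       (\<forall>l. \<bar>partial l (\<lambda>z. metric_comp g c z $ Ucoord $ Ucoord - (- 1)) z\<bar> \<le> \<eta> * (z $ Rcoord) powr (- 1))) \<and>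
     (\<forall>c. \<bar>metric_comp g c z $ Ucoord $ Rcoord - (- 1)\<bar> \<le> \<eta> * (z $ Rcoord) powr 0 \<and>
       (\<forall>l. \<bar>partial l (\<lambda>z. metric_comp g c z $ Ucoord $ Rcoord - (- 1)) z\<bar> \<le> \<eta> * (z $ Rcoord) powr (- 1))) \<and>
     (\<forall>I c. \<bar>metric_comp g c z $ Ucoord $ Angle I\<bar> \<le> \<eta> * (z $ Rcoord) powr 1 \<and>
       (\<forall>l. \<bar>partial l (\<lambda>z. metric_comp g c z $ Ucoord $ Angle I) z\<bar> \<le> \<eta> * (z $ Rcoord) powr 0)) \<and>
     (\<forall>I J c. \<bar>metric_comp g c z $ Angle I $ Angle J - round_comp c (angles z) $ I $ J * (z $ Rcoord)\<^sup>2\<bar> \<le> \<eta> * (z $ Rcoord) powr 2 \<and>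
       (\<forall>l. \<bar>partial l (\<lambda>z. metric_comp g c z $ Angle I $ Angle J - round_comp c (angles z) $ I $ J * (z $ Rcoord)\<^sup>2) z\<bar> \<le> \<eta> * (z $ Rcoord) powr 1))"
    using ev unfolding eventually_scri by blast
  show thesis
  proof (rule that[of "max (max 1 M) (R0 + 1)"])
    fix c :: bool and z :: "real^('n coord)"
    assume z: "z \<in> coord_region T R0" "z $ Rcoord \<ge> max (max 1 M) (R0 + 1)" "norm (angles z) \<le> 1"
    then have r: "z $ Rcoord > 0" and zM: "z $ Rcoord \<ge> M" and zT: "z $ Ucoord \<in> T"
      by (auto simp: coord_region_def)
    note Mz = M[OF zM zT z(3)]
    show "\<bar>metric_comp g c z $ Ucoord $ Ucoord + 1\<bar> \<le> \<eta> \<and> \<bar>metric_comp g c z $ Ucoord $ Rcoord + 1\<bar> \<le> \<eta> \<and>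
      (\<forall>I. \<bar>metric_comp g c z $ Ucoord $ Angle I\<bar> \<le> \<eta> * z $ Rcoord) \<and>
      (\<forall>I J. \<bar>metric_comp g c z $ Angle I $ Angle J - round_comp c (angles z) $ I $ J * (z $ Rcoord)\<^sup>2\<bar> \<le> \<eta> * (z $ Rcoord)\<^sup>2)"
      using Mz r by simp
    fix l
    show "\<bar>z $ Rcoord * partial l (\<lambda>w. metric_comp g c w $ Ucoord $ Ucoord) z\<bar> \<le> \<eta> \<and>
      \<bar>z $ Rcoord * partial l (\<lambda>w. metric_comp g c w $ Ucoord $ Rcoord) z\<bar> \<le> \<eta> \<and>
      (\<forall>I. \<bar>z $ Rcoord * partial l (\<lambda>w. metric_comp g c w $ Ucoord $ Angle I) z\<bar> \<le> \<eta> * z $ Rcoord) \<and>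
      (\<forall>I J. \<bar>z $ Rcoord * (partial l (\<lambda>w. metric_comp g c w $ Angle I $ Angle J) z
          - partial l (\<lambda>w. round_comp c (angles w) $ I $ J * (w $ Rcoord)\<^sup>2) z)\<bar> \<le> \<eta> * (z $ Rcoord)\<^sup>2)"
    proof (intro conjI allI)
      have 1: "\<bar>z $ Rcoord * X\<bar> \<le> \<eta>" if "\<bar>X\<bar> \<le> \<eta> * (z $ Rcoord) powr (- 1)" for X
        using that r by (simp add: abs_mult powr_minus field_simps)
      have 2: "\<bar>z $ Rcoord * X\<bar> \<le> \<eta> * z $ Rcoord" if "\<bar>X\<bar> \<le> \<eta> * (z $ Rcoord) powr 0" for X
        using that r by (simp add: abs_mult mult.commute)
      have 3: "\<bar>z $ Rcoord * X\<bar> \<le> \<eta> * (z $ Rcoord)\<^sup>2" if "\<bar>X\<bar> \<le> \<eta> * (z $ Rcoord) powr 1" for X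
        using mult_left_mono[OF that, of "z $ Rcoord"] r by (simp add: abs_mult power2_eq_square mult_ac)
      note Mz' = Mz[unfolded partial_diff_const[OF metric_comp_differentiable[OF z(1)]]
        partial_metric_comp_minus_round[OF z(1)]]
      show "\<bar>z $ Rcoord * partial l (\<lambda>w. metric_comp g c w $ Ucoord $ Ucoord) z\<bar> \<le> \<eta>"
        "\<bar>z $ Rcoord * partial l (\<lambda>w. metric_comp g c w $ Ucoord $ Rcoord) z\<bar> \<le> \<eta>"
        by (rule 1, use Mz' in blast)+
      show "\<bar>z $ Rcoord * partial l (\<lambda>w. metric_comp g c w $ Ucoord $ Angle I) z\<bar> \<le> \<eta> * z $ Rcoord" for I
        by (rule 2) (use Mz' in blast)
      show "\<bar>z $ Rcoord * (partial l (\<lambda>w. metric_comp g c w $ Angle I $ Angle J) z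
          - partial l (\<lambda>w. round_comp c (angles w) $ I $ J * (w $ Rcoord)\<^sup>2) z)\<bar> \<le> \<eta> * (z $ Rcoord)\<^sup>2" for I J
        by (rule 3) (use Mz' in blast)
    qed
  qed auto
qed

end

section \<open>Photons reaching future null infinity\<close>

lemma param_end_nontrivial: "0 < b \<Longrightarrow> param_end b \<noteq> bot"
proof
  assume "0 < b" "param_end b = bot"
  then have "eventually (\<lambda>_. False) (param_end b)" by simp
  then obtain P where P: "eventually P (at_left b)" "\<And>s. \<not> P (ereal s)"
    unfolding param_end_def eventually_filtercomap by blast
  obtain x where x: "x < b" "\<And>y. x < y \<Longrightarrow> y < b \<Longrightarrow> P y"
    using P(1) \<open>0 < b\<close> eventually_at_left by blast
  obtain s where "x < ereal s" "ereal s < b" using ereal_dense2[OF x(1)] by blast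
  then show False using P(2) x(2) by blast
qed

context bondi_asymptotically_flat
begin

text \<open>The region itself is not closed, but its part with r \<ge> R1 and u at least the initial
  value is, because \<open>R1 > R0\<close> and the interval \<open>T\<close> has no upper
  end.\<close>

lemma region_limit:
  assumes b: "0 < b" and reg: "\<gamma> ` params b \<subseteq> region T R0"
    and lim: "(\<gamma> \<longlongrightarrow> p) (param_end b)"
    and r: "\<And>s. s \<in> params b \<Longrightarrow> R1 \<le> r_of (\<gamma> s)" "R1 > R0"
    and u: "\<And>s. s \<in> params b \<Longrightarrow> u_of (\<gamma> 0) \<le> u_of (\<gamma> s)"
  shows "p \<in> region T R0"
proof -
  obtain pu pr px where p: "p = (pu, pr, px)" by (cases p)
  note nontriv = param_end_nontrivial[OF b]
  have ev: "eventually P (param_end b)" if "\<And>s. s \<in> params b \<Longrightarrow> P s" for P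
    by (rule eventually_param_end[OF zero_in_params[OF b] that])
  have lu: "((\<lambda>s. u_of (\<gamma> s)) \<longlongrightarrow> pu) (param_end b)" and lr: "((\<lambda>s. r_of (\<gamma> s)) \<longlongrightarrow> pr) (param_end b)"
    and lx: "((\<lambda>s. snd (snd (\<gamma> s))) \<longlongrightarrow> px) (param_end b)"
    using tendsto_fst[OF lim] tendsto_fst[OF tendsto_snd[OF lim]] tendsto_snd[OF tendsto_snd[OF lim]]
    by (simp_all add: p u_of_def r_of_def case_prod_unfold)
  have "R1 \<le> pr" by (rule tendsto_lowerbound[OF lr ev nontriv]) (rule r)
  moreover have u0: "u_of (\<gamma> 0) \<le> pu" by (rule tendsto_lowerbound[OF lu ev nontriv]) (rule u)
  have "pu \<in> T"
  proof -
    obtain t where "t \<in> T" "pu < t" using u_range(3) by (auto simp: bdd_above_def not_le)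
    moreover have "\<gamma> 0 \<in> region T R0" using reg zero_in_params[OF b] by auto
    then have "u_of (\<gamma> 0) \<in> T" by (auto simp: region_def u_of_def)
    ultimately show ?thesis using u_range(2) u0 by (metis mem_is_interval_1_I less_imp_le)
  qed
  moreover have "px \<in> sphere 0 1"
  proof (rule Lim_in_closed_set[OF closed_sphere ev nontriv lx])
    fix s assume "s \<in> params b"
    then have "\<gamma> s \<in> region T R0" using reg by auto
    then show "snd (snd (\<gamma> s)) \<in> sphere 0 1" by (auto simp: region_def)
  qed
  ultimately show ?thesis using r(2) by (simp add: p region_def)
qed

text \<open>Both with the sign that makes them positive for a future-directed photon.\<close>

definition mom_r :: "ereal \<Rightarrow> (real \<Rightarrow> 'n event) \<Rightarrow> real \<Rightarrow> real" where
  "mom_r b \<gamma> s = - g (\<gamma> s) (0, 1, 0) (velocity \<gamma> b s)"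

definition mom_u :: "ereal \<Rightarrow> (real \<Rightarrow> 'n event) \<Rightarrow> real \<Rightarrow> real" where
  "mom_u b \<gamma> s = - g (\<gamma> s) (1, 0, 0) (velocity \<gamma> b s)"

text \<open>The conclusion names no chart, so it can be used along the whole worldline although the
  chart in the proof depends on the point.\<close>

lemma local_estimates:
  assumes n: "n \<ge> 5"
  obtains R1 where "R1 \<ge> 1" "R1 > R0"
    and "\<And>b \<gamma> s. geodesic g b \<gamma> \<Longrightarrow> \<gamma> ` params b \<subseteq> region T R0 \<Longrightarrow> s \<in> params b \<Longrightarrow>
      g (\<gamma> s) (velocity \<gamma> b s) (velocity \<gamma> b s) = 0 \<Longrightarrow> 0 \<le> fst (velocity \<gamma> b s) \<Longrightarrow> r_of (\<gamma> s) \<ge> R1 \<Longrightarrow>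
      \<exists>guu gur gu gh kuu kur ku kh luu lur lu lh.
        perturbed_null (1/30000) (fst (velocity \<gamma> b s)) (fst (snd (velocity \<gamma> b s)))
          (r_of (\<gamma> s) * norm (snd (snd (velocity \<gamma> b s)))) guu gur gu gh kuu kur ku kh luu lur lu lh
          (r_of (\<gamma> s) * velocity (mom_r b \<gamma>) b s) (r_of (\<gamma> s) * velocity (mom_u b \<gamma>) b s) (mom_r b \<gamma> s) (mom_u b \<gamma> s)"
proof -
  define K where "K = real CARD('n)"
  have K: "K \<ge> 1" unfolding K_def by (simp add: Suc_leI)
  \<comment> \<open>Component bounds are summed over one or two angular indices, costing a factor
    \<open>K\<close> or \<open>K\<^sup>2\<close>; dividing in advance leaves 1/30000 for the
    contracted quantities.\<close>
  define \<eta> where "\<eta> = (1/30000) / K\<^sup>2"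
  have \<eta>: "\<eta> > 0" "\<eta> * K\<^sup>2 = 1/30000" using K by (auto simp: \<eta>_def)
  have \<eta>_le: "\<eta> \<le> 1/30000" "\<eta> * K \<le> 1/30000"
  proof -
    have "1 * 1 \<le> K * K" "K * 1 \<le> K * K" using K by (intro mult_mono; simp)+
    then have "\<eta> * 1 \<le> \<eta> * K\<^sup>2" "\<eta> * K \<le> \<eta> * K\<^sup>2"
      using \<eta>(1) by (simp_all add: power2_eq_square)
    then show "\<eta> \<le> 1/30000" "\<eta> * K \<le> 1/30000" unfolding \<eta>(2) by simp_all
  qed
  obtain R1 where R1: "R1 \<ge> 1" "R1 > R0"
    and near: "\<And>c z. z \<in> coord_region T R0 \<Longrightarrow> z $ Rcoord \<ge> R1 \<Longrightarrow> norm (angles z) \<le> 1 \<Longrightarrow>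
      \<bar>metric_comp g c z $ Ucoord $ Ucoord + 1\<bar> \<le> \<eta> \<and> \<bar>metric_comp g c z $ Ucoord $ Rcoord + 1\<bar> \<le> \<eta> \<and>
      (\<forall>I. \<bar>metric_comp g c z $ Ucoord $ Angle I\<bar> \<le> \<eta> * z $ Rcoord) \<and>
      (\<forall>I J. \<bar>metric_comp g c z $ Angle I $ Angle J - round_comp c (angles z) $ I $ J * (z $ Rcoord)\<^sup>2\<bar> \<le> \<eta> * (z $ Rcoord)\<^sup>2)"
    and near': "\<And>c l z. z \<in> coord_region T R0 \<Longrightarrow> z $ Rcoord \<ge> R1 \<Longrightarrow> norm (angles z) \<le> 1 \<Longrightarrow>
      \<bar>z $ Rcoord * partial l (\<lambda>w. metric_comp g c w $ Ucoord $ Ucoord) z\<bar> \<le> \<eta> \<and>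
      \<bar>z $ Rcoord * partial l (\<lambda>w. metric_comp g c w $ Ucoord $ Rcoord) z\<bar> \<le> \<eta> \<and>
      (\<forall>I. \<bar>z $ Rcoord * partial l (\<lambda>w. metric_comp g c w $ Ucoord $ Angle I) z\<bar> \<le> \<eta> * z $ Rcoord) \<and>
      (\<forall>I J. \<bar>z $ Rcoord * (partial l (\<lambda>w. metric_comp g c w $ Angle I $ Angle J) z
          - partial l (\<lambda>w. round_comp c (angles w) $ I $ J * (w $ Rcoord)\<^sup>2) z)\<bar> \<le> \<eta> * (z $ Rcoord)\<^sup>2)"
    using metric_near_flat[OF n \<eta>(1)] by blast
  show thesis
  proof (rule that[OF R1])
    fix b \<gamma> s
    assume geo: "geodesic g b \<gamma>" and reg: "\<gamma> ` params b \<subseteq> region T R0" and s: "s \<in> params b"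
      and null: "g (\<gamma> s) (velocity \<gamma> b s) (velocity \<gamma> b s) = 0" and a0: "0 \<le> fst (velocity \<gamma> b s)"
      and rR: "r_of (\<gamma> s) \<ge> R1"
    obtain u r x where p: "\<gamma> s = (u, r, x)" by (cases "\<gamma> s")
    have preg: "\<gamma> s \<in> region T R0" using reg s by auto
    then have x: "x \<in> sphere 0 1" by (simp add: p region_def)
    \<comment> \<open>The chart that has the current point in its closed hemisphere, where the
      metric estimates are available.\<close>
    obtain c where c: "pole c * fst x \<le> 0" using hemisphere_chart_exists by blast
    note ch1 = norm_stereo_le_1[OF x c]
    have ch: "\<gamma> s \<in> chart_domain c" using ch1 by (simp add: p chart_domain_def)
    define z where "z = (\<lambda>t. coords_of c (\<gamma> t))"
    define v where "v = velocity z b s"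
    have zs: "z s \<in> coord_region T R0" unfolding z_def by (rule coords_of_in_coord_region[OF preg])
    have zR: "z s $ Rcoord = r" "r_of (\<gamma> s) = r" and zn: "norm (angles (z s)) \<le> 1"
      using ch1 by (simp_all add: z_def p r_of_def)
    have r: "r \<ge> R1" "r > 0" using rR R1 by (simp_all add: zR)
    have vel: "velocity \<gamma> b s = tangent c (z s) v"
      unfolding v_def z_def by (rule velocity_eq[OF s chart_velocity(1)[OF geo reg s ch]])
    let ?G = "\<lambda>i j. metric_comp g c (z s) $ i $ j"
    let ?D = "\<lambda>l i j. partial l (\<lambda>w. metric_comp g c w $ i $ j) (z s)"
    let ?w = "angles v"
    let ?Y = "r * norm (snd (snd (velocity \<gamma> b s)))"
    \<comment> \<open>The conformal factor of the chart. On the unit ball it is at least 1, so the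
      coordinate speed \<open>norm ?w\<close> is at most the true angular speed.\<close>
    define \<mu> where "\<mu> = 2 / (angles (z s) \<bullet> angles (z s) + 1)"
    have \<mu>: "\<mu> \<ge> 1"
    proof -
      have "angles (z s) \<bullet> angles (z s) \<le> 1"
        using zn by (simp add: power2_norm_eq_inner[symmetric] power_le_one)
      then show ?thesis using inner_self_plus_1(1)[of "angles (z s)"] by (simp add: \<mu>_def)
    qed
    have Y: "?Y = r * (\<mu> * norm ?w)"
      by (simp add: vel tangent_def norm_dstereo \<mu>_def)
    have wY: "r * norm ?w \<le> ?Y"
      unfolding Y using \<mu> r by (intro mult_left_mono) (auto simp: mult_le_cancel_right1)
    have wY2: "r\<^sup>2 * (norm ?w)\<^sup>2 \<le> ?Y\<^sup>2"
      using power_mono[OF wY, of 2] r by (simp add: power_mult_distrib)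
    have round: "(\<Sum>I\<in>UNIV. \<Sum>J\<in>UNIV. round_comp c (angles (z s)) $ I $ J * ?w $ I * ?w $ J) = \<mu>\<^sup>2 * (norm ?w)\<^sup>2"
    proof -
      have "round_comp c (angles (z s)) $ I $ J * ?w $ I * ?w $ J = (if I = J then \<mu>\<^sup>2 * (?w $ I * ?w $ I) else 0)" for I J
        by (simp add: sphere_comp_inner \<mu>_def)
      then have "(\<Sum>I\<in>UNIV. \<Sum>J\<in>UNIV. round_comp c (angles (z s)) $ I $ J * ?w $ I * ?w $ J) =
        (\<Sum>I\<in>UNIV. \<mu>\<^sup>2 * (?w $ I * ?w $ I))" by simp
      also have "\<dots> = \<mu>\<^sup>2 * (?w \<bullet> ?w)" by (simp add: inner_vec_def sum_distrib_left)
      finally show ?thesis by (simp add: power2_norm_eq_inner)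
    qed
    have Y_sq: "k * ?Y\<^sup>2 = (\<Sum>I\<in>UNIV. \<Sum>J\<in>UNIV. (k * (round_comp c (angles (z s)) $ I $ J * r\<^sup>2)) * ?w $ I * ?w $ J)" for k
    proof -
      have "(\<Sum>I\<in>UNIV. \<Sum>J\<in>UNIV. (k * (round_comp c (angles (z s)) $ I $ J * r\<^sup>2)) * ?w $ I * ?w $ J) =
        k * r\<^sup>2 * (\<Sum>I\<in>UNIV. \<Sum>J\<in>UNIV. round_comp c (angles (z s)) $ I $ J * ?w $ I * ?w $ J)"
        by (simp add: sum_distrib_left mult_ac)
      then show ?thesis unfolding Y round by (simp add: power_mult_distrib mult_ac)
    qed
    have lin_bound: "\<bar>\<Sum>I\<in>UNIV. f I * ?w $ I\<bar> \<le> 1/30000 * ?Y" if "\<And>I. \<bar>f I\<bar> \<le> \<eta> * r" for f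
    proof -
      have "\<bar>\<Sum>I\<in>UNIV. f I * ?w $ I\<bar> \<le> \<eta> * r * K * norm ?w"
        unfolding K_def by (rule abs_sum_component_le) (rule that)
      also have "\<dots> = (\<eta> * K) * (r * norm ?w)" by (simp add: mult_ac)
      also have "\<dots> \<le> 1/30000 * ?Y" using \<eta>_le wY r by (intro mult_mono) auto
      finally show ?thesis .
    qed
    have quad_bound: "\<bar>\<Sum>I\<in>UNIV. \<Sum>J\<in>UNIV. f I J * ?w $ I * ?w $ J\<bar> \<le> 1/30000 * ?Y\<^sup>2"
      if "\<And>I J. \<bar>f I J\<bar> \<le> \<eta> * r\<^sup>2" for f
    proof -
      have "\<bar>\<Sum>I\<in>UNIV. \<Sum>J\<in>UNIV. f I J * ?w $ I * ?w $ J\<bar> \<le> \<eta> * r\<^sup>2 * K\<^sup>2 * (norm ?w)\<^sup>2"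
        unfolding K_def by (rule abs_double_sum_component_le) (rule that)
      also have "\<dots> = (\<eta> * K\<^sup>2) * (r\<^sup>2 * (norm ?w)\<^sup>2)" by (simp add: mult_ac)
      also have "\<dots> \<le> 1/30000 * ?Y\<^sup>2" unfolding \<eta>(2) using wY2 by simp
      finally show ?thesis .
    qed
    have Gsym: "?G i j = ?G j i" for i j by (rule metric_comp_sym[OF zs])
    have Dsym: "?D l i j = ?D l j i" for l i j by (rule partial_metric_comp_sym[OF zs])
    define gu where "gu = (\<Sum>I\<in>UNIV. ?G Ucoord (Angle I) * ?w $ I)"
    define gh where "gh = (\<Sum>I\<in>UNIV. \<Sum>J\<in>UNIV. ?G (Angle I) (Angle J) * ?w $ I * ?w $ J)"
    define du where "du l = (\<Sum>I\<in>UNIV. (r * ?D l Ucoord (Angle I)) * ?w $ I)" for l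
    define dh where "dh l = (\<Sum>I\<in>UNIV. \<Sum>J\<in>UNIV. (r * ?D l (Angle I) (Angle J)) * ?w $ I * ?w $ J)" for l
    note nr = near[where z = "z s" and c = c, OF zs, unfolded zR(1), OF r(1) zn]
    note nr' = near'[where z = "z s" and c = c, OF zs, unfolded zR(1), OF r(1) zn]
    have vcomp: "fst (velocity \<gamma> b s) = v $ Ucoord" "fst (snd (velocity \<gamma> b s)) = v $ Rcoord"
      by (simp_all add: vel tangent_def)
    have mom: "g (\<gamma> s) (partial l (event_of c) (z s)) (velocity \<gamma> b s) = (\<Sum>k\<in>UNIV. ?G l k * v $ k)" for l
      unfolding z_def v_def by (rule momentum_chart[OF geo reg s ch])
    have q: "mom_r b \<gamma> s = - (?G Ucoord Rcoord * v $ Ucoord)"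
      using mom[of Rcoord] by (simp add: mom_r_def partial_event_of sum_coord metric_comp_R[OF zs] Gsym[of Rcoord Ucoord])
    have e: "mom_u b \<gamma> s = - (?G Ucoord Ucoord * v $ Ucoord + ?G Ucoord Rcoord * v $ Rcoord + gu)"
      using mom[of Ucoord] by (simp add: mom_u_def partial_event_of sum_coord gu_def angles_def)
    have form: "(\<Sum>i\<in>UNIV. \<Sum>j\<in>UNIV. ?D l i j * v $ i * v $ j) * r =
      r * ?D l Ucoord Ucoord * (v $ Ucoord)\<^sup>2 + 2 * (r * ?D l Ucoord Rcoord) * v $ Ucoord * v $ Rcoord
        + 2 * v $ Ucoord * du l + dh l" for l
      unfolding du_def dh_def
      by (subst quadratic_form_coord[OF Dsym partial_metric_comp_R[OF zs]])
        (simp add: algebra_simps sum_distrib_left)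
    have dmom: "(mom_r b \<gamma> has_real_derivative - ((1/2) * (\<Sum>i\<in>UNIV. \<Sum>j\<in>UNIV. ?D Rcoord i j * v $ i * v $ j))) (at s within params b)"
      "(mom_u b \<gamma> has_real_derivative - ((1/2) * (\<Sum>i\<in>UNIV. \<Sum>j\<in>UNIV. ?D Ucoord i j * v $ i * v $ j))) (at s within params b)"
      using DERIV_minus[OF momentum_derivative[OF geo reg s ch, of Rcoord]]
        DERIV_minus[OF momentum_derivative[OF geo reg s ch, of Ucoord]]
      by (simp_all add: mom_r_def[abs_def] mom_u_def[abs_def] partial_event_of v_def z_def)
    have dq: "2 * (r * velocity (mom_r b \<gamma>) b s) = - (r * ?D Rcoord Ucoord Ucoord * (v $ Ucoord)\<^sup>2
        + 2 * (r * ?D Rcoord Ucoord Rcoord) * v $ Ucoord * v $ Rcoord + 2 * v $ Ucoord * du Rcoord + dh Rcoord)"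
      using velocity_eq[OF s dmom(1)[unfolded has_real_derivative_iff_has_vector_derivative]]
      by (simp add: form[symmetric])
    have de: "2 * (r * velocity (mom_u b \<gamma>) b s) = - (r * ?D Ucoord Ucoord Ucoord * (v $ Ucoord)\<^sup>2
        + 2 * (r * ?D Ucoord Ucoord Rcoord) * v $ Ucoord * v $ Rcoord + 2 * v $ Ucoord * du Ucoord + dh Ucoord)"
      using velocity_eq[OF s dmom(2)[unfolded has_real_derivative_iff_has_vector_derivative]]
      by (simp add: form[symmetric])
    have null': "?G Ucoord Ucoord * (v $ Ucoord)\<^sup>2 + 2 * ?G Ucoord Rcoord * v $ Ucoord * v $ Rcoord
        + 2 * v $ Ucoord * gu + gh = 0"
    proof -
      have "(\<Sum>i\<in>UNIV. \<Sum>j\<in>UNIV. ?G i j * v $ i * v $ j) = g (\<gamma> s) (velocity \<gamma> b s) (velocity \<gamma> b s)"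
        using metric_comp_sum(1)[OF zs, of c v v] event_of_coords_of[OF preg ch] by (simp add: vel) (simp add: z_def)
      then show ?thesis
        using null unfolding gu_def gh_def quadratic_form_coord[OF Gsym metric_comp_R[OF zs]] by simp
    qed
    have gh_bound: "\<bar>gh - ?Y\<^sup>2\<bar> \<le> 1/30000 * ?Y\<^sup>2"
    proof -
      have "gh - ?Y\<^sup>2 = (\<Sum>I\<in>UNIV. \<Sum>J\<in>UNIV. (?G (Angle I) (Angle J) - round_comp c (angles (z s)) $ I $ J * r\<^sup>2) * ?w $ I * ?w $ J)"
        using Y_sq[of 1] unfolding gh_def by (simp only: left_diff_distrib sum_subtractf mult_1)
      then show ?thesis using quad_bound nr by simp
    qed
    have dh_R: "\<bar>dh Rcoord - 2 * ?Y\<^sup>2\<bar> \<le> 1/30000 * ?Y\<^sup>2"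
    proof -
      have "dh Rcoord - 2 * ?Y\<^sup>2 = (\<Sum>I\<in>UNIV. \<Sum>J\<in>UNIV. (r * (?D Rcoord (Angle I) (Angle J)
          - partial Rcoord (\<lambda>w. round_comp c (angles w) $ I $ J * (w $ Rcoord)\<^sup>2) (z s))) * ?w $ I * ?w $ J)"
        unfolding Y_sq[of 2] dh_def partial_round_comp zR(1) sum_subtractf[symmetric]
        by (intro sum.cong refl) (simp add: algebra_simps power2_eq_square)
      then show ?thesis using quad_bound nr'[of Rcoord] by simp
    qed
    have dh_U: "\<bar>dh Ucoord\<bar> \<le> 1/30000 * ?Y\<^sup>2"
      unfolding dh_def using quad_bound nr'[of Ucoord] by (simp add: partial_round_comp)
    have "perturbed_null (1/30000) (v $ Ucoord) (v $ Rcoord) ?Y (?G Ucoord Ucoord) (?G Ucoord Rcoord) gu gh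
        (r * ?D Rcoord Ucoord Ucoord) (r * ?D Rcoord Ucoord Rcoord) (du Rcoord) (dh Rcoord)
        (r * ?D Ucoord Ucoord Ucoord) (r * ?D Ucoord Ucoord Rcoord) (du Ucoord) (dh Ucoord)
        (r * velocity (mom_r b \<gamma>) b s) (r * velocity (mom_u b \<gamma>) b s) (mom_r b \<gamma> s) (mom_u b \<gamma> s)"
    proof
      show "\<bar>gu\<bar> \<le> 1/30000 * ?Y" unfolding gu_def by (rule lin_bound) (use nr in blast)
      show "\<bar>du Rcoord\<bar> \<le> 1/30000 * ?Y" "\<bar>du Ucoord\<bar> \<le> 1/30000 * ?Y"
        unfolding du_def by (rule lin_bound, use nr' in blast)+
      show "\<bar>?G Ucoord Ucoord + 1\<bar> \<le> 1/30000" "\<bar>?G Ucoord Rcoord + 1\<bar> \<le> 1/30000"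
        by (rule order_trans[OF _ \<eta>_le(1)], use nr in blast)+
      show "\<bar>r * ?D Rcoord Ucoord Ucoord\<bar> \<le> 1/30000" "\<bar>r * ?D Rcoord Ucoord Rcoord\<bar> \<le> 1/30000"
        "\<bar>r * ?D Ucoord Ucoord Ucoord\<bar> \<le> 1/30000" "\<bar>r * ?D Ucoord Ucoord Rcoord\<bar> \<le> 1/30000"
        by (rule order_trans[OF _ \<eta>_le(1)], use nr' in blast)+
      show "0 \<le> v $ Ucoord" using a0 by (simp only: vcomp)
      show "0 \<le> ?Y" using r by simp
    qed (fact gh_bound dh_R dh_U null' q e dq de | simp)+
    then show "\<exists>guu gur gu gh kuu kur ku kh luu lur lu lh.
        perturbed_null (1/30000) (fst (velocity \<gamma> b s)) (fst (snd (velocity \<gamma> b s)))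
          (r_of (\<gamma> s) * norm (snd (snd (velocity \<gamma> b s)))) guu gur gu gh kuu kur ku kh luu lur lu lh
          (r_of (\<gamma> s) * velocity (mom_r b \<gamma>) b s) (r_of (\<gamma> s) * velocity (mom_u b \<gamma>) b s) (mom_r b \<gamma> s) (mom_u b \<gamma> s)"
      unfolding vcomp zR(2) by blast
  qed
qed

lemma photon_reaches_scri:
  assumes n: "n \<ge> 5"
  shows "\<exists>R>0. \<forall>b \<gamma>. photon T R0 g b \<gamma> \<and> r_of (\<gamma> 0) \<ge> R \<and>
    velocity (u_of \<circ> \<gamma>) b 0 \<noteq> 0 \<and> rdot b \<gamma> 0 \<ge> - (423/1000) \<longrightarrow> reaches_scri b \<gamma>"
proof -
  obtain R1 where R1_ge: "R1 \<ge> 1" "R1 > R0"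
    and est: "\<And>b \<gamma> s. geodesic g b \<gamma> \<Longrightarrow> \<gamma> ` params b \<subseteq> region T R0 \<Longrightarrow> s \<in> params b \<Longrightarrow>
      g (\<gamma> s) (velocity \<gamma> b s) (velocity \<gamma> b s) = 0 \<Longrightarrow> 0 \<le> fst (velocity \<gamma> b s) \<Longrightarrow> r_of (\<gamma> s) \<ge> R1 \<Longrightarrow>
      \<exists>guu gur gu gh kuu kur ku kh luu lur lu lh.
        perturbed_null (1/30000) (fst (velocity \<gamma> b s)) (fst (snd (velocity \<gamma> b s)))
          (r_of (\<gamma> s) * norm (snd (snd (velocity \<gamma> b s)))) guu gur gu gh kuu kur ku kh luu lur lu lh
          (r_of (\<gamma> s) * velocity (mom_r b \<gamma>) b s) (r_of (\<gamma> s) * velocity (mom_u b \<gamma>) b s) (mom_r b \<gamma> s) (mom_u b \<gamma> s)"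
    using local_estimates[OF n] by blast
  show ?thesis
  \<comment> \<open>The added 1 makes the initial inequality of \<open>photon_estimates\<close>
    strict.\<close>
  proof (intro exI[of _ "R1 * exp 6 + 1"] conjI allI impI)
    show "0 < R1 * exp 6 + 1" using R1_ge by (intro add_pos_pos mult_pos_pos) auto
    fix b \<gamma>
    assume "photon T R0 g b \<gamma> \<and> r_of (\<gamma> 0) \<ge> R1 * exp 6 + 1 \<and>
      velocity (u_of \<circ> \<gamma>) b 0 \<noteq> 0 \<and> rdot b \<gamma> 0 \<ge> - (423/1000)"
    then have b: "0 < b" and reg: "\<gamma> ` params b \<subseteq> region T R0" and geo: "geodesic g b \<gamma>"
      and fn: "\<And>s. s \<in> params b \<Longrightarrow> future_null g (\<gamma> s) (velocity \<gamma> b s)"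
      and inext: "\<And>p. p \<in> region T R0 \<Longrightarrow> \<not> (\<gamma> \<longlongrightarrow> p) (param_end b)"
      and r0: "r_of (\<gamma> 0) \<ge> R1 * exp 6 + 1" and u0: "velocity (u_of \<circ> \<gamma>) b 0 \<noteq> 0"
      and rdot0: "rdot b \<gamma> 0 \<ge> - (423/1000)"
      by (auto simp: photon_def)
    let ?v = "velocity \<gamma> b"
    have zero: "0 \<in> params b" by (rule zero_in_params[OF b])
    have chart: "\<exists>c. \<gamma> s \<in> chart_domain c" if "s \<in> params b" for s
    proof -
      obtain u r x where p: "\<gamma> s = (u, r, x)" by (cases "\<gamma> s")
      have "\<gamma> s \<in> region T R0" using reg that by auto
      then have "x \<in> sphere 0 1" by (simp add: p region_def)
      with hemisphere_chart_exists[of x] norm_stereo_le_1(1)[of x] show ?thesis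
        by (auto simp: p chart_domain_def)
    qed
    have d\<gamma>: "(\<gamma> has_vector_derivative ?v s) (at s within params b)" if s: "s \<in> params b" for s
    proof -
      obtain c where "\<gamma> s \<in> chart_domain c" using chart[OF s] by blast
      note v = chart_velocity(1)[OF geo reg s this]
      then show ?thesis by (simp add: velocity_eq[OF s v])
    qed
    have du: "((u_of \<circ> \<gamma>) has_real_derivative fst (?v s)) (at s within params b)"
      and dr: "((r_of \<circ> \<gamma>) has_real_derivative fst (snd (?v s))) (at s within params b)"
      if s: "s \<in> params b" for s
      using bounded_linear.has_vector_derivative[OF bounded_linear_fst d\<gamma>[OF s]]
        bounded_linear.has_vector_derivative[OF bounded_linear_fst
          bounded_linear.has_vector_derivative[OF bounded_linear_snd d\<gamma>[OF s]]]
      by (simp_all add: has_real_derivative_iff_has_vector_derivative u_of_def r_of_def o_def case_prod_unfold)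
    have dp: "(mom_r b \<gamma> has_real_derivative velocity (mom_r b \<gamma>) b s) (at s within params b)"
      "(mom_u b \<gamma> has_real_derivative velocity (mom_u b \<gamma>) b s) (at s within params b)" if s: "s \<in> params b" for s
    proof -
      obtain c where ch: "\<gamma> s \<in> chart_domain c" using chart[OF s] by blast
      have "\<exists>d. (mom_r b \<gamma> has_real_derivative d) (at s within params b)"
        "\<exists>d. (mom_u b \<gamma> has_real_derivative d) (at s within params b)"
        using DERIV_minus[OF momentum_derivative[OF geo reg s ch, of Rcoord]]
          DERIV_minus[OF momentum_derivative[OF geo reg s ch, of Ucoord]]
        by (auto simp: mom_r_def[abs_def] mom_u_def[abs_def] partial_event_of)
      then show "(mom_r b \<gamma> has_real_derivative velocity (mom_r b \<gamma>) b s) (at s within params b)"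
        "(mom_u b \<gamma> has_real_derivative velocity (mom_u b \<gamma>) b s) (at s within params b)"
        using velocity_eq[OF s] unfolding has_real_derivative_iff_has_vector_derivative by blast+
    qed
    have null: "g (\<gamma> s) (?v s) (?v s) = 0" if "s \<in> params b" for s
      using fn[OF that] by (simp add: future_null_def)
    have du_nonneg: "0 \<le> fst (?v s)" if s: "s \<in> params b" for s
    proof -
      obtain u r x where p: "\<gamma> s = (u, r, x)" by (cases "\<gamma> s")
      obtain a k w where v: "?v s = (a, k, w)" by (cases "?v s")
      have "(u, r, x) \<in> region T R0" using reg s p by force
      note hb = h_bilinear[OF this]
      \<comment> \<open>The product with \<open>d_r\<close> is -exp(B) u', so the first alternative
        of \<open>future_null\<close> gives u' > 0 and the second, a multiple of \<open>d_r\<close>,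
        gives u' = 0.\<close>
      have "a > 0 \<or> a = 0"
        using fn[OF s] by (auto simp: future_null_def p v d_r_def g_apply bilinear_rzero[OF hb] zero_less_mult_iff)
      then show ?thesis by (auto simp: v)
    qed
    have du0: "fst (?v 0) > 0"
      using u0 velocity_eq[OF zero du[OF zero, unfolded has_real_derivative_iff_has_vector_derivative]]
        du_nonneg[OF zero] by simp
    have rdot_eq: "rdot b \<gamma> 0 = fst (snd (?v 0)) / fst (?v 0)"
      using velocity_eq[OF zero du[OF zero, unfolded has_real_derivative_iff_has_vector_derivative]]
        velocity_eq[OF zero dr[OF zero, unfolded has_real_derivative_iff_has_vector_derivative]]
      by (simp add: rdot_def)
    have "R1 * 1 \<le> R1 * exp 6" using R1_ge by (intro mult_left_mono) auto
    then have r0': "r_of (\<gamma> 0) \<ge> R1" using r0 by simp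
    have "mom_r b \<gamma> 0 > 0 \<and> mom_u b \<gamma> 0 > 56/100 * mom_r b \<gamma> 0"
    proof -
      obtain guu gur gu gh kuu kur ku kh luu lur lu lh where
        "perturbed_null (1/30000) (fst (?v 0)) (fst (snd (?v 0)))
          (r_of (\<gamma> 0) * norm (snd (snd (?v 0)))) guu gur gu gh kuu kur ku kh luu lur lu lh
          (r_of (\<gamma> 0) * velocity (mom_r b \<gamma>) b 0) (r_of (\<gamma> 0) * velocity (mom_u b \<gamma>) b 0) (mom_r b \<gamma> 0) (mom_u b \<gamma> 0)"
        using est[OF geo reg zero null[OF zero] du_nonneg[OF zero] r0'] by blast
      then interpret P: perturbed_null "1/30000" "fst (?v 0)" "fst (snd (?v 0))"
          "r_of (\<gamma> 0) * norm (snd (snd (?v 0)))" guu gur gu gh kuu kur ku kh luu lur lu lh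
          "r_of (\<gamma> 0) * velocity (mom_r b \<gamma>) b 0" "r_of (\<gamma> 0) * velocity (mom_u b \<gamma>) b 0" "mom_r b \<gamma> 0" "mom_u b \<gamma> 0" .
      show ?thesis
        using P.above_critical[OF du0] P.q_close(2) du0 rdot0 by (simp add: rdot_eq)
    qed
    then have init: "mom_r b \<gamma> 0 > 0" "mom_u b \<gamma> 0 > 56/100 * mom_r b \<gamma> 0" by blast+
    interpret photon_estimates b \<gamma> ?v "u_of \<circ> \<gamma>" "r_of \<circ> \<gamma>" "mom_r b \<gamma>" "mom_u b \<gamma>"
      "\<lambda>s. fst (?v s)" "\<lambda>s. fst (snd (?v s))" "velocity (mom_r b \<gamma>) b" "velocity (mom_u b \<gamma>) b" R1
    proof
      show "(r_of \<circ> \<gamma>) 0 > R1 * exp 6" using r0 by simp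
      fix s assume s: "s \<in> params b"
      assume "(r_of \<circ> \<gamma>) s \<ge> R1"
      then have rs: "r_of (\<gamma> s) \<ge> R1" by simp
      obtain guu gur gu gh kuu kur ku kh luu lur lu lh where
        "perturbed_null (1/30000) (fst (?v s)) (fst (snd (?v s)))
          (r_of (\<gamma> s) * norm (snd (snd (?v s)))) guu gur gu gh kuu kur ku kh luu lur lu lh
          (r_of (\<gamma> s) * velocity (mom_r b \<gamma>) b s) (r_of (\<gamma> s) * velocity (mom_u b \<gamma>) b s) (mom_r b \<gamma> s) (mom_u b \<gamma> s)"
        using est[OF geo reg s null[OF s] du_nonneg[OF s] rs] by blast
      then interpret P: perturbed_null "1/30000" "fst (?v s)" "fst (snd (?v s))"
          "r_of (\<gamma> s) * norm (snd (snd (?v s)))" guu gur gu gh kuu kur ku kh luu lur lu lh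
          "r_of (\<gamma> s) * velocity (mom_r b \<gamma>) b s" "r_of (\<gamma> s) * velocity (mom_u b \<gamma>) b s" "mom_r b \<gamma> s" "mom_u b \<gamma> s" .
      show "\<bar>(r_of \<circ> \<gamma>) s * velocity (mom_r b \<gamma>) b s\<bar> \<le> 10 * mom_r b \<gamma> s * (mom_r b \<gamma> s + \<bar>mom_u b \<gamma> s\<bar>)"
        using P.abs_dq_le by simp
      assume pos: "mom_r b \<gamma> s > 0" "mom_u b \<gamma> s \<ge> mom_r b \<gamma> s / 2"
      show "\<bar>(r_of \<circ> \<gamma>) s * velocity (mom_u b \<gamma>) b s * mom_r b \<gamma> s - mom_u b \<gamma> s * ((r_of \<circ> \<gamma>) s * velocity (mom_r b \<gamma>) b s)
          - fst (?v s) * (2 * (mom_u b \<gamma> s)\<^sup>2 - mom_u b \<gamma> s * mom_r b \<gamma> s)\<bar> \<le> 1/100 * fst (?v s) * (mom_u b \<gamma> s)\<^sup>2"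
        using P.quotient_derivative_approx[OF pos] by simp
      show "\<bar>fst (snd (?v s)) * mom_r b \<gamma> s - fst (?v s) * (mom_u b \<gamma> s - mom_r b \<gamma> s)\<bar> \<le> 1/100 * fst (?v s) * mom_u b \<gamma> s"
        using P.b_approx[OF pos] by simp
      have "norm (?v s) \<le> norm (fst (?v s)) + (norm (fst (snd (?v s))) + norm (snd (snd (?v s))))"
        using norm_Pair_le[of "fst (?v s)" "snd (?v s)"] norm_Pair_le[of "fst (snd (?v s))" "snd (snd (?v s))"] by simp
      \<comment> \<open>As r \<ge> 1, the Euclidean speed on the unit sphere is at most the physical
        one r |x'|.\<close>
      also have "\<dots> \<le> fst (?v s) + (\<bar>fst (snd (?v s))\<bar> + r_of (\<gamma> s) * norm (snd (snd (?v s))))"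
        using du_nonneg[OF s] rs R1_ge by (simp add: mult_le_cancel_right1)
      also have "\<dots> \<le> 25 * fst (?v s) * (mom_u b \<gamma> s / mom_r b \<gamma> s)"
        using P.speed_le[OF pos] by simp
      finally show "norm (?v s) \<le> 25 * fst (?v s) * (mom_u b \<gamma> s / mom_r b \<gamma> s)" .
    qed (use b du dr dp d\<gamma> du_nonneg R1_ge init in simp_all)
    have "\<not> bdd_above (Q ` params b)"
    proof
      assume "bdd_above (Q ` params b)"
      then obtain K where "\<And>s. s \<in> params b \<Longrightarrow> Q s \<le> K" by (auto simp: bdd_above_def)
      then obtain p where p: "(\<gamma> \<longlongrightarrow> p) (param_end b)" using converges_if_Q_bounded by blast
      have "p \<in> region T R0"
        by (rule region_limit[OF b reg p _ R1_ge(2)])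
          (use good_r(1) always_good u_mono[OF zero] in \<open>auto simp: params_def\<close>)
      then show False using inext p by blast
    qed
    then have "filterlim (r_of \<circ> \<gamma>) at_top (param_end b)" by (rule r_tends_to_infinity)
    moreover have "bounded ((u_of \<circ> \<gamma>) ` params b)"
    proof (rule bounded_subset[OF bounded_closed_interval])
      show "(u_of \<circ> \<gamma>) ` params b \<subseteq> {(u_of \<circ> \<gamma>) 0 .. (u_of \<circ> \<gamma>) 0 + 2 * ((r_of \<circ> \<gamma>) 0 / Q 0)}"
        using u_bounded u_mono[OF zero] by (auto simp: params_def)
    qed
    ultimately show "reaches_scri b \<gamma>" by (simp add: reaches_scri_def)
  qed
qed

end

text \<open>Rests on 3 * 577^2 = 998787 < 1000^2.\<close>

lemma rdot_crit_ge: "rdot_crit \<ge> - (423/1000)"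
proof -
  have "sqrt 3 \<le> 1000/577"
    by (rule real_le_lsqrt) (simp_all add: power2_eq_square)
  then have "1 / (1000/577) \<le> 1 / sqrt 3" by (intro divide_left_mono) auto
  then show ?thesis by (simp add: rdot_crit_def)
qed

theorem mainTheorem2:
  fixes n :: nat
    and T :: "real set" and R0 :: real
    and A B :: "real \<Rightarrow> real \<Rightarrow> 'n::finite ambient \<Rightarrow> real"
    and C :: "real \<Rightarrow> real \<Rightarrow> 'n ambient \<Rightarrow> 'n ambient"
    and h :: "real \<Rightarrow> real \<Rightarrow> 'n ambient \<Rightarrow> 'n ambient \<Rightarrow> 'n ambient \<Rightarrow> real"
    and A1 m B1 :: "real \<Rightarrow> 'n ambient \<Rightarrow> real"
    and C1 :: "real \<Rightarrow> 'n ambient \<Rightarrow> 'n ambient \<Rightarrow> real"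
    and h1 :: "real \<Rightarrow> 'n ambient \<Rightarrow> 'n ambient \<Rightarrow> 'n ambient \<Rightarrow> real"
    and \<epsilon> :: "real \<Rightarrow> real"
  assumes "n \<ge> 5"
    and "bondi_asymptotically_flat n T R0 A B C h A1 m B1 C1 h1"
    and "\<And>r0. r0 > 0 \<Longrightarrow> \<epsilon> r0 > 0"
    and "(\<lambda>r0. 1 / \<epsilon> r0) \<in> o[at_top](\<lambda>r0. r0)"
  shows "\<exists>R>0. \<forall>r0\<ge>R. \<forall>b \<gamma>.
    photon T R0 (bondi_metric A B C h) b \<gamma> \<and> r_of (\<gamma> 0) = r0 \<and>
    velocity (u_of \<circ> \<gamma>) b 0 \<noteq> 0 \<and> rdot b \<gamma> 0 - rdot_crit \<ge> \<epsilon> r0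
    \<longrightarrow> reaches_scri b \<gamma>"
proof -
  obtain R where R: "R > 0" "\<And>b \<gamma>. photon T R0 (bondi_metric A B C h) b \<gamma> \<and> r_of (\<gamma> 0) \<ge> R \<and>
    velocity (u_of \<circ> \<gamma>) b 0 \<noteq> 0 \<and> rdot b \<gamma> 0 \<ge> - (423/1000) \<Longrightarrow> reaches_scri b \<gamma>"
    using bondi_asymptotically_flat.photon_reaches_scri[OF assms(2,1)] by blast
  show ?thesis
  proof (intro exI[of _ R] conjI allI impI)
    fix r0 b \<gamma>
    assume "r0 \<ge> R" and *: "photon T R0 (bondi_metric A B C h) b \<gamma> \<and> r_of (\<gamma> 0) = r0 \<and>
      velocity (u_of \<circ> \<gamma>) b 0 \<noteq> 0 \<and> rdot b \<gamma> 0 - rdot_crit \<ge> \<epsilon> r0"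
    then have "\<epsilon> r0 > 0" using R(1) assms(3) by simp
    then have "rdot b \<gamma> 0 \<ge> - (423/1000)" using * rdot_crit_ge by linarith
    then show "reaches_scri b \<gamma>" using R(2)[of b \<gamma>] * \<open>r0 \<ge> R\<close> by simp
  qed (rule R(1))
qed

end
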